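(* Let $A\subset B$ be a (unital) inclusion of separable, unital $\mathrm{C}^*$-algebras with the Rokhlin property. Then the inclusion $*$-homomorphism $A\hookrightarrow B$ is sequentially split.
   Context: $A_\infty=\ell^\infty(\mathbb{N},A)/c_0(\mathbb{N},A)$; $A$ embeds canonically into $A_\infty$ as constant sequences. A $*$-homomorphism $\varphi:A\to B$ is sequentially split if there is a $*$-homomorphism $\psi:B\to A_\infty$ with $\psi\circ\varphi$ the canonical inclusion $A\hookrightarrow A_\infty$. Let $A\subset B$ be a unital inclusion of unital $\mathrm{C}^*$-algebras and $E:B\to A$ a conditional expectation. $E$ has a quasi-basis (finite Watatani index) if there are $u_1,v_1,\dots,u_n,v_n\in B$ with $x=\sum_{j=1}^n u_jE(v_jx)=\sum_{j=1}^nE(xu_j)v_j$ for all $x\in B$; then $\mathrm{ind}(E)=\sum_{j=1}^n u_jv_j$, which is independent of the quasi-basis and a positive, central, invertible element of $B$. For separable $A\subset B$, such an $E$ has the Rokhlin property if there is a projection $p\in B_\infty\cap B'$ with $E_\infty(p)=\mathrm{ind}(E)^{-1}$ and such that $x\mapsto px$ is injective on $B$, where $E_\infty:B_\infty\to A_\infty$ is the componentwise extension of $E$. The inclusion $A\subset B$ has the Rokhlin property if some conditional expectation $E:B\to A$ with finite Watatani index has the Rokhlin property (equivalently, such expectations exist and all of them have it). *)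

theory Defs
  imports "HOL-Analysis.Analysis"
begin

section \<open>Unital C*-algebras\<close>

class unital_star_algebra = ring + monoid_mult +
  fixes scaleC :: "complex \<Rightarrow> 'a \<Rightarrow> 'a"  (infixr \<open>*\<^sub>C\<close> 75)
    and adj :: "'a \<Rightarrow> 'a"
  assumes scaleC_add_right: "c *\<^sub>C (x + y) = c *\<^sub>C x + c *\<^sub>C y"
    and scaleC_add_left: "(c + d) *\<^sub>C x = c *\<^sub>C x + d *\<^sub>C x"
    and scaleC_scaleC: "c *\<^sub>C (d *\<^sub>C x) = (c * d) *\<^sub>C x"
    and scaleC_one: "1 *\<^sub>C x = x"
    and mult_scaleC_left: "(c *\<^sub>C x) * y = c *\<^sub>C (x * y)"
    and mult_scaleC_right: "x * (c *\<^sub>C y) = c *\<^sub>C (x * y)"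
    and adj_adj: "adj (adj x) = x"
    and adj_add: "adj (x + y) = adj x + adj y"
    and adj_scaleC: "adj (c *\<^sub>C x) = cnj c *\<^sub>C adj x"
    and adj_mult: "adj (x * y) = adj y * adj x"

text \<open>The superclass \<^class>\<open>real_normed_algebra\<close> (rather than its variant with unit) is used because
  that variant demands \<open>0 \<noteq> 1\<close>; the zero algebra is thus not excluded here.\<close>

class unital_cstar_algebra = unital_star_algebra + real_normed_algebra + banach +
  assumes scaleR_scaleC: "scaleR r x = complex_of_real r *\<^sub>C x"
    and norm_scaleC: "norm (c *\<^sub>C x) = cmod c * norm x"
    and norm_adj_mult: "norm (adj x * x) = (norm x)\<^sup>2"

definition star_hom :: "('a::unital_star_algebra \<Rightarrow> 'b::unital_star_algebra) \<Rightarrow> bool" where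
  "star_hom f \<longleftrightarrow>
     (\<forall>x y. f (x + y) = f x + f y) \<and> (\<forall>c x. f (c *\<^sub>C x) = c *\<^sub>C f x) \<and>
     (\<forall>x y. f (x * y) = f x * f y) \<and> (\<forall>x. f (adj x) = adj (f x))"

definition positive :: "'a::unital_star_algebra \<Rightarrow> bool" where
  "positive x \<longleftrightarrow> (\<exists>y. x = adj y * y)"

definition projection :: "'a::unital_star_algebra \<Rightarrow> bool" where
  "projection p \<longleftrightarrow> adj p = p \<and> p * p = p"

lemma adj_zero [simp]: "adj (0 :: 'a::unital_star_algebra) = 0"
  using adj_add[of "0 :: 'a" 0] by simp

lemma adj_minus: "adj (- x :: 'a::unital_star_algebra) = - adj x"
  using adj_add[of x "- x"] by (simp add: eq_neg_iff_add_eq_0 add.commute)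

lemma adj_diff: "adj (x - y :: 'a::unital_star_algebra) = adj x - adj y"
  using adj_add[of x "- y"] by (simp add: adj_minus)

lemma scaleC_zero [simp]: "c *\<^sub>C (0 :: 'a::unital_star_algebra) = 0"
  using scaleC_add_right[of c "0 :: 'a" 0] by simp

lemma scaleC_diff: "c *\<^sub>C (x - y :: 'a::unital_star_algebra) = c *\<^sub>C x - c *\<^sub>C y"
  using scaleC_add_right[of c "x - y" y] by (simp add: eq_diff_eq)

lemma norm_adj_le: "norm (x :: 'a::unital_cstar_algebra) \<le> norm (adj x)"
proof (cases "x = 0")
  case False
  have "norm x * norm x \<le> norm (adj x) * norm x"
    using norm_mult_ineq[of "adj x" x] by (simp add: norm_adj_mult power2_eq_square)
  with False show ?thesis by simp
qed simp

lemma norm_adj [simp]: "norm (adj x :: 'a::unital_cstar_algebra) = norm x"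
  using norm_adj_le[of x] norm_adj_le[of "adj x"] by (simp add: adj_adj)


section \<open>The sequence algebra\<close>

definition seq_rel :: "(nat \<Rightarrow> 'a::unital_cstar_algebra) \<Rightarrow> (nat \<Rightarrow> 'a) \<Rightarrow> bool" where
  "seq_rel x y \<longleftrightarrow> Bseq x \<and> Bseq y \<and> (\<lambda>n. x n - y n) \<longlonglongrightarrow> 0"

lemma part_equivp_seq_rel: "part_equivp (seq_rel :: (nat \<Rightarrow> 'a::unital_cstar_algebra) \<Rightarrow> _)"
proof (rule part_equivpI)
  show "\<exists>x :: nat \<Rightarrow> 'a. seq_rel x x"
    by (rule exI[of _ "\<lambda>_. 0"]) (simp add: seq_rel_def)
  show "symp (seq_rel :: (nat \<Rightarrow> 'a) \<Rightarrow> _)"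
  proof (rule sympI)
    fix x y :: "nat \<Rightarrow> 'a" assume "seq_rel x y"
    then show "seq_rel y x"
      using tendsto_minus[of "\<lambda>n. x n - y n" 0 sequentially] by (simp add: seq_rel_def)
  qed
  show "transp (seq_rel :: (nat \<Rightarrow> 'a) \<Rightarrow> _)"
  proof (rule transpI)
    fix x y z :: "nat \<Rightarrow> 'a" assume "seq_rel x y" "seq_rel y z"
    then show "seq_rel x z"
      using tendsto_add[of "\<lambda>n. x n - y n" 0 sequentially "\<lambda>n. y n - z n" 0]
      by (simp add: seq_rel_def)
  qed
qed

text \<open>The type \<open>'a seq_algebra\<close> is the quotient of the bounded sequences in \<open>'a\<close> by the sequences
  that tend to zero. Only its *-algebra structure is needed below: *-homomorphisms, projections and
  relative commutants are purely algebraic notions.\<close>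

quotient_type (overloaded) 'a seq_algebra =
  "nat \<Rightarrow> 'a::unital_cstar_algebra" / partial: seq_rel
  by (rule part_equivp_seq_rel)

lemma Bseq_plus:
  fixes x y :: "nat \<Rightarrow> 'a::real_normed_vector"
  assumes "Bseq x" "Bseq y" shows "Bseq (\<lambda>n. x n + y n)"
proof -
  from assms obtain K L where "\<And>n. norm (x n) \<le> K" "\<And>n. norm (y n) \<le> L"
    by (auto simp: Bseq_def)
  then have "norm (x n + y n) \<le> K + L" for n
    by (meson add_mono norm_triangle_ineq order_trans)
  then show ?thesis by (rule BseqI')
qed

lemma Bseq_scaleC: "Bseq x \<Longrightarrow> Bseq (\<lambda>n. c *\<^sub>C (x n :: 'a::unital_cstar_algebra))"
proof -
  assume "Bseq x"
  then obtain K where "\<And>n. norm (x n) \<le> K" by (auto simp: Bseq_def)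
  then have "norm (c *\<^sub>C x n) \<le> cmod c * K" for n
    by (simp add: norm_scaleC mult_left_mono)
  then show ?thesis by (rule BseqI')
qed

lemma Bseq_times:
  fixes x y :: "nat \<Rightarrow> 'a::real_normed_algebra"
  assumes "Bseq x" "Bseq y" shows "Bseq (\<lambda>n. x n * y n)"
proof -
  from assms obtain K L where "K > 0" "\<And>n. norm (x n) \<le> K" "\<And>n. norm (y n) \<le> L"
    by (auto simp: Bseq_def)
  then have "norm (x n * y n) \<le> K * L" for n
    by (meson less_imp_le mult_mono norm_ge_zero norm_mult_ineq order_trans)
  then show ?thesis by (rule BseqI')
qed

lemma Bseq_times_null:
  fixes x y :: "nat \<Rightarrow> 'a::real_normed_algebra"
  assumes "Bseq x" "y \<longlonglongrightarrow> 0"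
  shows "(\<lambda>n. x n * y n) \<longlonglongrightarrow> 0" "(\<lambda>n. y n * x n) \<longlonglongrightarrow> 0"
proof -
  have "Zfun y sequentially" using assms(2) by (simp add: tendsto_Zfun_iff)
  moreover have "Bfun x sequentially" using assms(1) by simp
  ultimately show "(\<lambda>n. x n * y n) \<longlonglongrightarrow> 0" "(\<lambda>n. y n * x n) \<longlonglongrightarrow> 0"
    using bounded_bilinear.Bfun_prod_Zfun[OF bounded_bilinear_mult]
      bounded_bilinear.Zfun_prod_Bfun[OF bounded_bilinear_mult]
    by (auto simp: tendsto_Zfun_iff)
qed

instantiation seq_algebra :: (unital_cstar_algebra) unital_star_algebra
begin

lift_definition zero_seq_algebra :: "'a seq_algebra" is "\<lambda>_. 0"
  by (simp add: seq_rel_def)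

lift_definition one_seq_algebra :: "'a seq_algebra" is "\<lambda>_. 1"
  by (simp add: seq_rel_def)

lift_definition plus_seq_algebra :: "'a seq_algebra \<Rightarrow> 'a seq_algebra \<Rightarrow> 'a seq_algebra"
  is "\<lambda>x y n. x n + y n"
proof -
  fix x x' y y' :: "nat \<Rightarrow> 'a" assume h: "seq_rel x x'" "seq_rel y y'"
  then have "(\<lambda>n. (x n - x' n) + (y n - y' n)) \<longlonglongrightarrow> 0 + 0"
    unfolding seq_rel_def by (intro tendsto_add) auto
  with h show "seq_rel (\<lambda>n. x n + y n) (\<lambda>n. x' n + y' n)"
    by (simp add: seq_rel_def Bseq_plus algebra_simps)
qed

lift_definition uminus_seq_algebra :: "'a seq_algebra \<Rightarrow> 'a seq_algebra" is "\<lambda>x n. - x n"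
proof -
  fix x x' :: "nat \<Rightarrow> 'a" assume h: "seq_rel x x'"
  then have "(\<lambda>n. - (x n - x' n)) \<longlonglongrightarrow> - 0"
    unfolding seq_rel_def by (intro tendsto_minus) auto
  with h show "seq_rel (\<lambda>n. - x n) (\<lambda>n. - x' n)"
    by (simp add: seq_rel_def Bseq_minus_iff)
qed

definition minus_seq_algebra :: "'a seq_algebra \<Rightarrow> 'a seq_algebra \<Rightarrow> 'a seq_algebra" where
  "minus_seq_algebra x y = x + (- y)"

lift_definition times_seq_algebra :: "'a seq_algebra \<Rightarrow> 'a seq_algebra \<Rightarrow> 'a seq_algebra"
  is "\<lambda>x y n. x n * y n"
proof -
  fix x x' y y' :: "nat \<Rightarrow> 'a" assume h: "seq_rel x x'" "seq_rel y y'"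
  then have "(\<lambda>n. x n * (y n - y' n)) \<longlonglongrightarrow> 0" "(\<lambda>n. (x n - x' n) * y' n) \<longlonglongrightarrow> 0"
    by (auto simp: seq_rel_def intro: Bseq_times_null)
  from tendsto_add[OF this] h show "seq_rel (\<lambda>n. x n * y n) (\<lambda>n. x' n * y' n)"
    by (simp add: seq_rel_def Bseq_times algebra_simps)
qed

lift_definition scaleC_seq_algebra :: "complex \<Rightarrow> 'a seq_algebra \<Rightarrow> 'a seq_algebra"
  is "\<lambda>c x n. c *\<^sub>C x n"
proof -
  fix c and x x' :: "nat \<Rightarrow> 'a" assume h: "seq_rel x x'"
  then have "(\<lambda>n. norm (c *\<^sub>C (x n - x' n))) \<longlonglongrightarrow> cmod c * 0"
    unfolding norm_scaleC seq_rel_def by (intro tendsto_mult_left tendsto_norm_zero) auto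
  then have "(\<lambda>n. c *\<^sub>C (x n - x' n)) \<longlonglongrightarrow> 0"
    by (simp add: tendsto_norm_zero_iff)
  with h show "seq_rel (\<lambda>n. c *\<^sub>C x n) (\<lambda>n. c *\<^sub>C x' n)"
    by (simp add: seq_rel_def Bseq_scaleC scaleC_diff)
qed

lift_definition adj_seq_algebra :: "'a seq_algebra \<Rightarrow> 'a seq_algebra" is "\<lambda>x n. adj (x n)"
proof -
  fix x x' :: "nat \<Rightarrow> 'a" assume h: "seq_rel x x'"
  then have "(\<lambda>n. norm (adj (x n - x' n))) \<longlonglongrightarrow> 0"
    by (simp add: seq_rel_def tendsto_norm_zero_iff)
  then have "(\<lambda>n. adj (x n - x' n)) \<longlonglongrightarrow> 0"
    by (simp only: tendsto_norm_zero_iff)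
  with h show "seq_rel (\<lambda>n. adj (x n)) (\<lambda>n. adj (x' n))"
    by (simp add: seq_rel_def Bseq_def adj_diff)
qed

instance
proof
  fix x y z :: "'a seq_algebra" and c d :: complex
  show "x + y + z = x + (y + z)"
    by transfer (simp add: seq_rel_def Bseq_plus add.assoc)
  show "x + y = y + x"
    by transfer (simp add: seq_rel_def Bseq_plus add.commute)
  show "0 + x = x"
    by transfer (simp add: seq_rel_def)
  show "- x + x = 0"
    by transfer (simp add: seq_rel_def)
  show "x - y = x + - y"
    by (rule minus_seq_algebra_def)
  show "x * y * z = x * (y * z)"
    by transfer (simp add: seq_rel_def Bseq_times mult.assoc)
  show "(x + y) * z = x * z + y * z"
    by transfer (simp add: seq_rel_def Bseq_plus Bseq_times distrib_right)
  show "x * (y + z) = x * y + x * z"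
    by transfer (simp add: seq_rel_def Bseq_plus Bseq_times distrib_left)
  show "1 * x = x"
    by transfer (simp add: seq_rel_def)
  show "x * 1 = x"
    by transfer (simp add: seq_rel_def)
  show "c *\<^sub>C (x + y) = c *\<^sub>C x + c *\<^sub>C y"
    by transfer (simp add: seq_rel_def Bseq_plus Bseq_scaleC scaleC_add_right)
  show "(c + d) *\<^sub>C x = c *\<^sub>C x + d *\<^sub>C x"
    by transfer (simp add: seq_rel_def Bseq_plus Bseq_scaleC scaleC_add_left)
  show "c *\<^sub>C (d *\<^sub>C x) = (c * d) *\<^sub>C x"
    by transfer (simp add: seq_rel_def Bseq_scaleC scaleC_scaleC)
  show "1 *\<^sub>C x = x"
    by transfer (simp add: seq_rel_def scaleC_one)
  show "(c *\<^sub>C x) * y = c *\<^sub>C (x * y)"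
    by transfer (simp add: seq_rel_def Bseq_scaleC Bseq_times mult_scaleC_left)
  show "x * (c *\<^sub>C y) = c *\<^sub>C (x * y)"
    by transfer (simp add: seq_rel_def Bseq_scaleC Bseq_times mult_scaleC_right)
  show "adj (adj x) = x"
    by transfer (simp add: seq_rel_def adj_adj)
  show "adj (x + y) = adj x + adj y"
    by transfer (simp add: seq_rel_def Bseq_def[of "\<lambda>n. adj (_ n)"] Bseq_def[symmetric]
        Bseq_plus adj_add[symmetric])
  show "adj (c *\<^sub>C x) = cnj c *\<^sub>C adj x"
    by transfer (simp add: seq_rel_def Bseq_def[of "\<lambda>n. adj (_ n)"] Bseq_def[symmetric]
        Bseq_scaleC adj_scaleC[symmetric])
  show "adj (x * y) = adj y * adj x"
    by transfer (simp add: seq_rel_def Bseq_def[of "\<lambda>n. adj (_ n)"] Bseq_def[symmetric]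
        Bseq_times adj_mult[symmetric])
qed

end

lift_definition const_seq :: "'a::unital_cstar_algebra \<Rightarrow> 'a seq_algebra" is "\<lambda>a _. a"
  by (simp add: seq_rel_def)

text \<open>The componentwise extension of a map. It applies the map to an arbitrary representing sequence;
  for bounded linear maps, the only ones it is used for, the choice does not matter (see
  \<open>seq_map_abs\<close> below).\<close>

definition seq_map ::
  "('a::unital_cstar_algebra \<Rightarrow> 'b::unital_cstar_algebra) \<Rightarrow> 'a seq_algebra \<Rightarrow> 'b seq_algebra" where
  "seq_map f X = abs_seq_algebra (\<lambda>n. f (rep_seq_algebra X n))"

lemma seq_map_abs:
  assumes f: "bounded_linear f" and x: "Bseq x"
  shows "seq_map f (abs_seq_algebra x) = abs_seq_algebra (\<lambda>n. f (x n))"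
proof -
  define y where "y = rep_seq_algebra (abs_seq_algebra x)"
  have "seq_rel x x" using x by (simp add: seq_rel_def)
  then have yx: "seq_rel y x"
    unfolding y_def by (rule Quotient3_rep_abs[OF Quotient3_seq_algebra])
  have "Bseq (\<lambda>n. f (z n))" if z: "Bseq z" for z :: "nat \<Rightarrow> 'a"
  proof -
    obtain K where K: "K > 0" "\<And>a. norm (f a) \<le> norm a * K"
      using bounded_linear.pos_bounded[OF f] by blast
    from z obtain L where L: "\<forall>n. norm (z n) \<le> L"
      by (rule BseqE)
    have "norm (f (z n)) \<le> L * K" for n
      using K(2)[of "z n"] mult_right_mono[OF spec[OF L, of n], of K] K(1) by linarith
    then show ?thesis by (rule BseqI')
  qed
  moreover have "(\<lambda>n. f (y n) - f (x n)) \<longlonglongrightarrow> 0"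
    using bounded_linear.tendsto_zero[OF f, of "\<lambda>n. y n - x n"] yx
    by (simp add: seq_rel_def linear_diff[OF bounded_linear.linear[OF f]])
  ultimately have "seq_rel (\<lambda>n. f (y n)) (\<lambda>n. f (x n))"
    using yx by (simp add: seq_rel_def)
  then show ?thesis
    unfolding seq_map_def y_def[symmetric]
    by (rule Quotient3_rel_abs[OF Quotient3_seq_algebra])
qed


section \<open>Sequentially split *-homomorphisms\<close>

definition sequentially_split ::
  "('a::unital_cstar_algebra \<Rightarrow> 'b::unital_cstar_algebra) \<Rightarrow> bool" where
  "sequentially_split \<phi> \<longleftrightarrow>
     star_hom \<phi> \<and> (\<exists>\<psi> :: 'b \<Rightarrow> 'a seq_algebra. star_hom \<psi> \<and> \<psi> \<circ> \<phi> = const_seq)"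


section \<open>Inclusions and conditional expectations\<close>

text \<open>An inclusion \<open>A \<subseteq> B\<close> with common unit is given by its embedding \<open>\<iota>\<close>; being isometric, \<open>\<iota>\<close> identifies
  \<open>A\<close> with a norm-closed unital *-subalgebra of \<open>B\<close>.\<close>

definition unital_inclusion ::
  "('a::unital_cstar_algebra \<Rightarrow> 'b::unital_cstar_algebra) \<Rightarrow> bool" where
  "unital_inclusion \<iota> \<longleftrightarrow> star_hom \<iota> \<and> \<iota> 1 = 1 \<and> (\<forall>a. norm (\<iota> a) = norm a)"

definition conditional_expectation ::
  "('a::unital_cstar_algebra \<Rightarrow> 'b::unital_cstar_algebra) \<Rightarrow> ('b \<Rightarrow> 'a) \<Rightarrow> bool" where
  "conditional_expectation \<iota> E \<longleftrightarrow>
     (\<forall>x y. E (x + y) = E x + E y) \<and> (\<forall>c x. E (c *\<^sub>C x) = c *\<^sub>C E x) \<and>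
     (\<forall>x. positive x \<longrightarrow> positive (E x)) \<and> (\<forall>x. norm (E x) \<le> norm x) \<and>
     (\<forall>a. E (\<iota> a) = a) \<and>
     (\<forall>a x. E (\<iota> a * x) = a * E x) \<and> (\<forall>a x. E (x * \<iota> a) = E x * a)"

definition quasi_basis ::
  "('a::unital_cstar_algebra \<Rightarrow> 'b::unital_cstar_algebra) \<Rightarrow> ('b \<Rightarrow> 'a) \<Rightarrow>
     nat \<Rightarrow> (nat \<Rightarrow> 'b) \<Rightarrow> (nat \<Rightarrow> 'b) \<Rightarrow> bool" where
  "quasi_basis \<iota> E n u v \<longleftrightarrow>
     (\<forall>x. x = (\<Sum>j<n. u j * \<iota> (E (v j * x))) \<and> x = (\<Sum>j<n. \<iota> (E (x * u j)) * v j))"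

definition finite_watatani_index ::
  "('a::unital_cstar_algebra \<Rightarrow> 'b::unital_cstar_algebra) \<Rightarrow> ('b \<Rightarrow> 'a) \<Rightarrow> bool" where
  "finite_watatani_index \<iota> E \<longleftrightarrow> (\<exists>n u v. quasi_basis \<iota> E n u v)"

definition watatani_index ::
  "('a::unital_cstar_algebra \<Rightarrow> 'b::unital_cstar_algebra) \<Rightarrow> ('b \<Rightarrow> 'a) \<Rightarrow> 'b" where
  "watatani_index \<iota> E = (THE w. \<exists>n u v. quasi_basis \<iota> E n u v \<and> w = (\<Sum>j<n. u j * v j))"

lemma watatani_index_unique:
  assumes uv: "quasi_basis \<iota> E n u v" and uv': "quasi_basis \<iota> E m u' v'"
  shows "(\<Sum>j<n. u j * v j) = (\<Sum>k<m. u' k * v' k)"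
proof -
  have "(\<Sum>j<n. u j * v j) = (\<Sum>j<n. (\<Sum>k<m. u' k * \<iota> (E (v' k * u j))) * v j)"
    using uv' by (simp add: quasi_basis_def flip: sum_distrib_right)
  also have "\<dots> = (\<Sum>k<m. \<Sum>j<n. u' k * (\<iota> (E (v' k * u j)) * v j))"
    by (subst sum.swap) (simp add: sum_distrib_right mult.assoc)
  also have "\<dots> = (\<Sum>k<m. u' k * (\<Sum>j<n. \<iota> (E (v' k * u j)) * v j))"
    by (simp add: sum_distrib_left)
  also have "\<dots> = (\<Sum>k<m. u' k * v' k)"
    using uv by (simp add: quasi_basis_def)
  finally show ?thesis .
qed

lemma watatani_index_eq:
  assumes "quasi_basis \<iota> E n u v"
  shows "watatani_index \<iota> E = (\<Sum>j<n. u j * v j)"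
  unfolding watatani_index_def
  by (rule the_equality) (use assms watatani_index_unique in blast)+


section \<open>The Rokhlin property\<close>

text \<open>In \<open>expectation_rokhlin\<close>, \<open>w\<close> is the inverse of the index of \<open>E\<close>, and \<open>E\<^sub>\<infinity>(p)\<close> is viewed in
  \<open>B\<^sub>\<infinity>\<close> through the componentwise extension of \<open>\<iota>\<close>. The predicate is meant for
  conditional expectations of finite Watatani index.\<close>

definition expectation_rokhlin ::
  "('a::unital_cstar_algebra \<Rightarrow> 'b::unital_cstar_algebra) \<Rightarrow> ('b \<Rightarrow> 'a) \<Rightarrow> bool" where
  "expectation_rokhlin \<iota> E \<longleftrightarrow>
     (\<exists>(p :: 'b seq_algebra) (w :: 'b).
        projection p \<and> (\<forall>b. p * const_seq b = const_seq b * p) \<and>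
        w * watatani_index \<iota> E = 1 \<and> watatani_index \<iota> E * w = 1 \<and>
        seq_map \<iota> (seq_map E p) = const_seq w \<and>
        inj (\<lambda>b. p * const_seq b))"

definition inclusion_rokhlin ::
  "('a::unital_cstar_algebra \<Rightarrow> 'b::unital_cstar_algebra) \<Rightarrow> bool" where
  "inclusion_rokhlin \<iota> \<longleftrightarrow>
     (\<exists>E. conditional_expectation \<iota> E \<and> finite_watatani_index \<iota> E \<and> expectation_rokhlin \<iota> E)"

end

theory Submission
  imports Defs
begin

text \<open>Identify \<open>A\<close> with its image in \<open>B\<close>. Let \<open>p\<close> be a Rokhlin projection for \<open>E\<close> and \<open>k = ind(E)\<close>,
  which is central and, since \<open>E\<^sub>\<infinity>(p) = k\<^sup>-\<^sup>1\<close>, lies in \<open>A\<close>. The splitting is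
  \<open>\<psi>(b) = k E\<^sub>\<infinity>(p b)\<close>. It is linear, preserves adjoints because \<open>p\<close> and \<open>k\<close> commute with \<open>B\<close>, and maps
  \<open>a \<in> A\<close> to \<open>k E\<^sub>\<infinity>(p) a = a\<close>. Multiplicativity comes down to \<open>p b = p \<psi>(b)\<close>: then
  \<open>\<psi>(b) \<psi>(d) = k E\<^sub>\<infinity>(p b \<psi>(d)) = k E\<^sub>\<infinity>(b p \<psi>(d)) = k E\<^sub>\<infinity>(b p d) = \<psi>(b d)\<close>.

  In the basic construction, with Jones projection \<open>e\<close>, that identity says that \<open>p - k p e p\<close>
  vanishes. This is a projection whose dual expectation is \<open>p - k p k\<^sup>-\<^sup>1 p = 0\<close>, so it is zero
  because the dual expectation is faithful. Here the argument is carried out without the basic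
  construction, on the map \<open>T(x) = p x - k p E\<^sub>\<infinity>(p x)\<close>. For a quasi-basis \<open>(u, v)\<close> and
  \<open>t\<^sub>j = T(u\<^sub>j)\<close>, the vanishing of the dual expectation becomes
  \<open>\<Sum> t\<^sub>i E(v\<^sub>i v\<^sub>j*) t\<^sub>j* = 0\<close> (\<open>sum_defect\<close>), and faithfulness becomes an inequality that
  bounds \<open>T(x) T(x)*\<close> for \<open>T(x) = \<Sum> t\<^sub>i E(v\<^sub>i x)\<close> by \<open>(norm x)\<^sup>2\<close> times that sum
  (\<open>norm_sum_E_square_le\<close>).

  The inequality rests on the Schwarz inequality for \<open>E\<close>, which gives the positivity of a matrix over
  \<open>A\<close> tested on rows from \<open>A\<close>, and on the fact that such a matrix remains positive when it is tested on
  rows from \<open>B\<close> (\<open>nonneg_matrix_form_embedding\<close>). Both use the order of a C*-algebra: sums of positive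
  elements are positive, the norm is monotone on them, and every \<open>y* y\<close> is positive. These facts are
  derived from the C*-identity alone, the main device being a square root of \<open>1 - h\<close> for self-adjoint
  contractions \<open>h\<close> (\<open>root_one_minus\<close>); spectra and states do not occur.\<close>


section \<open>The order of a C*-algebra\<close>

lemma adj_one [simp]: "adj (1 :: 'a::unital_star_algebra) = 1"
  by (metis adj_adj adj_mult mult.right_neutral)

lemma scaleC_minus_left: "(- c) *\<^sub>C x = - (c *\<^sub>C (x :: 'a::unital_cstar_algebra))"
  using scaleC_add_left[of "-c" c x] norm_scaleC[of 0 x] by (simp add: eq_neg_iff_add_eq_0)

lemma adj_sum: "adj (sum f S) = (\<Sum>i\<in>S. adj (f i :: 'a::unital_star_algebra))"
  by (induction S rule: infinite_finite_induct) (simp_all add: adj_add)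

lemma adj_scaleR: "adj (r *\<^sub>R x) = r *\<^sub>R adj (x :: 'a::unital_cstar_algebra)"
  by (simp add: scaleR_scaleC adj_scaleC)

lemma norm_mult_adj: "norm (x * adj x :: 'a::unital_cstar_algebra) = (norm x)\<^sup>2"
  using norm_adj_mult[of "adj x"] by (simp add: adj_adj)

lemma norm_one_le: "norm (1 :: 'a::unital_cstar_algebra) \<le> 1"
proof -
  have "norm (1::'a) = norm (1::'a) * norm (1::'a)"
    using norm_adj_mult[of "1::'a"] by (simp add: power2_eq_square)
  then show ?thesis unfolding mult_cancel_right1 by auto
qed

lemma norm_scaleR_one_le: "norm (r *\<^sub>R (1 :: 'a::unital_cstar_algebra)) \<le> \<bar>r\<bar>"
  using norm_one_le[where 'a='a] by (simp add: mult_left_le)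

lemma norm_square_selfadjoint:
  "adj x = x \<Longrightarrow> norm (x * x :: 'a::unital_cstar_algebra) = (norm x)\<^sup>2"
  using norm_adj_mult[of x] by simp

lemma bounded_linear_adj: "bounded_linear (adj :: 'a::unital_cstar_algebra \<Rightarrow> 'a)"
  by (rule bounded_linear_intro[where K=1]) (simp_all add: adj_add adj_scaleR)

text \<open>The root is \<open>1 - r\<close>, where \<open>r\<close> solves \<open>r = (h + r\<^sup>2) / 2\<close>. The obvious iteration converges even
  when \<open>norm h = 1\<close>, since its increments are dominated by those of the same iteration for the real
  number \<open>1\<close> in place of \<open>h\<close>, which is increasing and bounded.\<close>

lemma root_one_minus:
  fixes h :: "'a::unital_cstar_algebra"
  assumes h: "adj h = h" "norm h \<le> 1"
  obtains s where "adj s = s" "s * s = 1 - h" "norm (1 - s) \<le> 1"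
    "\<And>y. y * h = h * y \<Longrightarrow> y * s = s * y"
proof -
  define \<rho> :: "nat \<Rightarrow> real" where "\<rho> = rec_nat 0 (\<lambda>_ x. (1 + x * x) / 2)"
  define r :: "nat \<Rightarrow> 'a" where "r = rec_nat 0 (\<lambda>_ x. (1/2) *\<^sub>R (h + x * x))"
  have \<rho>0 [simp]: "\<rho> 0 = 0" and \<rho>S: "\<rho> (Suc n) = (1 + \<rho> n * \<rho> n) / 2" for n
    by (simp_all add: \<rho>_def)
  have r0 [simp]: "r 0 = 0" and rS: "r (Suc n) = (1/2) *\<^sub>R (h + r n * r n)" for n
    by (simp_all add: r_def)
  have \<rho>: "0 \<le> \<rho> n \<and> \<rho> n \<le> 1" for n
  proof (induction n)
    case (Suc n)
    then have "\<rho> n * \<rho> n \<le> 1" by (simp add: mult_le_one)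
    then show ?case by (simp add: \<rho>S)
  qed simp
  have nr: "norm (r n) \<le> \<rho> n" for n
  proof (induction n)
    case (Suc n)
    have "norm (r n * r n) \<le> \<rho> n * \<rho> n"
      using norm_mult_ineq[of "r n" "r n"] mult_mono[OF Suc Suc] \<rho>[of n] by simp
    then show ?case
      using h(2) norm_triangle_ineq[of h "r n * r n"] by (simp add: rS \<rho>S)
  qed simp
  \<comment> \<open>\<open>r\<^sup>2 - r'\<^sup>2 = r (r - r') + (r - r') r'\<close>, and for real numbers the corresponding bound is exact.\<close>
  have inc: "norm (r (Suc n) - r n) \<le> \<rho> (Suc n) - \<rho> n" for n
  proof (induction n)
    case 0
    then show ?case using h(2) by (simp add: rS \<rho>S)
  next
    case (Suc n)
    let ?d = "r (Suc n) - r n"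
    have "r (Suc (Suc n)) - r (Suc n) = (1/2) *\<^sub>R (r (Suc n) * r (Suc n) - r n * r n)"
      by (simp only: rS[of "Suc n"] rS[of n] flip: scaleR_diff_right) simp
    also have "\<dots> = (1/2) *\<^sub>R (r (Suc n) * ?d + ?d * r n)"
      by (simp add: algebra_simps)
    finally have eq: "norm (r (Suc (Suc n)) - r (Suc n)) = (1/2) * norm (r (Suc n) * ?d + ?d * r n)"
      by simp
    have "norm (r (Suc n) * ?d) \<le> \<rho> (Suc n) * (\<rho> (Suc n) - \<rho> n)"
      using norm_mult_ineq[of "r (Suc n)" ?d] mult_mono[OF nr[of "Suc n"] Suc] \<rho>[of "Suc n"] by simp
    moreover have "norm (?d * r n) \<le> (\<rho> (Suc n) - \<rho> n) * \<rho> n"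
      using norm_mult_ineq[of ?d "r n"] mult_mono[OF Suc nr[of n]] Suc
      by (meson norm_ge_zero order_trans)
    ultimately have "norm (r (Suc n) * ?d + ?d * r n) \<le> \<rho> (Suc n) * \<rho> (Suc n) - \<rho> n * \<rho> n"
      using norm_triangle_ineq[of "r (Suc n) * ?d" "?d * r n"] by (simp add: algebra_simps)
    then show ?case unfolding eq by (simp add: \<rho>S[of "Suc n"] \<rho>S[of n] field_simps)
  qed
  have "incseq \<rho>" using inc norm_ge_zero by (metis diff_ge_0_iff_ge incseq_SucI order_trans)
  then obtain c where "\<rho> \<longlonglongrightarrow> c"
    using incseq_convergent[of \<rho> 1] \<rho> by blast
  then have "summable (\<lambda>n. \<rho> (Suc n) - \<rho> n)" by (rule telescope_summable)
  then have "summable (\<lambda>n. r (Suc n) - r n)"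
    using inc by (rule summable_comparison_test')
  then have "(\<lambda>n. \<Sum>i<n. r (Suc i) - r i) \<longlonglongrightarrow> (\<Sum>n. r (Suc n) - r n)"
    by (rule summable_LIMSEQ)
  then obtain R where R: "r \<longlonglongrightarrow> R"
    by (simp add: sum_lessThan_telescope)
  then have "(\<lambda>n. r (Suc n)) \<longlonglongrightarrow> (1/2) *\<^sub>R (h + R * R)"
    unfolding rS by (intro tendsto_intros)
  then have "R = (1/2) *\<^sub>R (h + R * R)"
    using LIMSEQ_unique LIMSEQ_Suc[OF R] by blast
  then have "R + R = h + R * R"
    by (metis scaleR_half_double scaleR_right_distrib)
  then have sq: "(1 - R) * (1 - R) = 1 - h"
    by (simp add: algebra_simps)
  have "adj (r n) = r n" for n
    by (induction n) (simp_all add: rS adj_scaleR adj_add adj_mult h(1))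
  then have "adj R = R"
    using LIMSEQ_unique[OF bounded_linear.tendsto[OF bounded_linear_adj R]] R by simp
  then have "adj (1 - R) = 1 - R" by (simp add: adj_diff)
  moreover have "norm (r n) \<le> 1" for n
    using nr[of n] \<rho>[of n] by linarith
  then have "norm (1 - (1 - R)) \<le> 1"
    using Lim_norm_ubound[OF sequentially_bot R] by simp
  moreover have "y * (1 - R) = (1 - R) * y" if y: "y * h = h * y" for y
  proof -
    have "y * r n = r n * y" for n
    proof (induction n)
      case (Suc n)
      then have "y * (r n * r n) = r n * r n * y"
        by (metis mult.assoc)
      then show ?case using y by (simp add: rS distrib_left distrib_right)
    qed simp
    then have "(\<lambda>n. y * r n) \<longlonglongrightarrow> R * y"
      using tendsto_mult_right[OF R, of y] by simp
    then have "y * R = R * y"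
      using tendsto_mult_left[OF R, of y] LIMSEQ_unique by blast
    then show ?thesis by (simp add: left_diff_distrib right_diff_distrib)
  qed
  ultimately show thesis
    using that[OF _ sq] by blast
qed

text \<open>An element is called nonnegative when the norm itself shows that its spectrum lies in an interval
  \<open>{0..2 * t}\<close>. In this form sums of nonnegative elements are visibly nonnegative; that this is
  the cone of the elements \<open>adj y * y\<close> is proved below.\<close>

definition nonneg :: "'a::unital_cstar_algebra \<Rightarrow> bool" where
  "nonneg x \<longleftrightarrow> adj x = x \<and> (\<exists>t. norm (t *\<^sub>R 1 - x) \<le> t)"

lemma nonneg_selfadjoint: "nonneg x \<Longrightarrow> adj x = x"
  by (simp add: nonneg_def)

lemma nonneg_zero [simp]: "nonneg 0"
  unfolding nonneg_def by (auto intro!: exI[of _ 0])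

lemma nonneg_add:
  assumes "nonneg x" "nonneg y" shows "nonneg (x + y)"
proof -
  obtain s t where "norm (s *\<^sub>R 1 - x) \<le> s" "norm (t *\<^sub>R 1 - y) \<le> t"
    using assms by (auto simp: nonneg_def)
  then have "norm ((s *\<^sub>R 1 - x) + (t *\<^sub>R 1 - y)) \<le> s + t"
    by (meson add_mono norm_triangle_ineq order_trans)
  then have "norm ((s + t) *\<^sub>R 1 - (x + y)) \<le> s + t"
    by (simp add: algebra_simps)
  then show ?thesis using assms unfolding nonneg_def adj_add by metis
qed

lemma nonneg_scaleR:
  assumes "nonneg x" "0 \<le> c" shows "nonneg (c *\<^sub>R x)"
proof -
  obtain t where "norm (t *\<^sub>R 1 - x) \<le> t" using assms by (auto simp: nonneg_def)
  then have "norm (c *\<^sub>R (t *\<^sub>R 1 - x)) \<le> c * t" using assms(2) by (simp add: mult_left_mono)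
  then have "norm ((c * t) *\<^sub>R 1 - c *\<^sub>R x) \<le> c * t" by (simp add: scaleR_diff_right)
  then show ?thesis using assms unfolding nonneg_def adj_scaleR by metis
qed

lemma nonneg_norm_minus: "adj z = z \<Longrightarrow> nonneg (norm z *\<^sub>R 1 - z)"
  unfolding nonneg_def by (auto simp: adj_diff adj_scaleR intro!: exI[of _ "norm z"])

lemma nonneg_root:
  fixes x :: "'a::unital_cstar_algebra"
  assumes "nonneg x"
  obtains s where "nonneg s" "s * s = x" "\<And>y. y * x = x * y \<Longrightarrow> y * s = s * y"
proof -
  obtain t where x: "adj x = x" and t: "norm (t *\<^sub>R 1 - x) \<le> t"
    using assms by (auto simp: nonneg_def)
  show thesis
  proof (cases "t = 0")
    case True
    with t have "x = 0" by simp
    then show thesis using that[of 0] by simp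
  next
    case False
    with order_trans[OF norm_ge_zero t] have t0: "t > 0" by simp
    define h where "h = 1 - (1/t) *\<^sub>R x"
    have "h = (1/t) *\<^sub>R (t *\<^sub>R 1 - x)"
      using t0 by (simp add: h_def scaleR_diff_right)
    then have nh: "norm h \<le> 1" using t t0 by simp
    have "adj h = h" using x by (simp add: h_def adj_diff adj_scaleR)
    from root_one_minus[OF this nh] obtain s where s: "adj s = s" "s * s = 1 - h" "norm (1 - s) \<le> 1"
      "\<And>y. y * h = h * y \<Longrightarrow> y * s = s * y"
      by blast
    have "nonneg s" using s(1,3) unfolding nonneg_def by (auto intro!: exI[of _ 1])
    then have "nonneg (sqrt t *\<^sub>R s)" using t0 by (simp add: nonneg_scaleR)
    moreover have "(sqrt t *\<^sub>R s) * (sqrt t *\<^sub>R s) = x"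
      using t0 by (simp add: s(2) h_def)
    moreover have "y * (sqrt t *\<^sub>R s) = (sqrt t *\<^sub>R s) * y" if "y * x = x * y" for y
    proof -
      have "y * h = h * y" using that by (simp add: h_def right_diff_distrib left_diff_distrib)
      then show ?thesis using s(4) by simp
    qed
    ultimately show thesis by (rule that)
  qed
qed

text \<open>The element \<open>a + \<i> b\<close> satisfies \<open>u* u = r\<close>, and \<open>a\<close> is its real part.\<close>

lemma norm_le_of_circle:
  fixes a b :: "'a::unital_cstar_algebra"
  assumes "adj a = a" "adj b = b" "a * b = b * a" "a * a + b * b = r *\<^sub>R 1"
  shows "(norm a)\<^sup>2 \<le> \<bar>r\<bar>"
proof -
  define u where "u = a + \<i> *\<^sub>C b"
  have au: "adj u = a - \<i> *\<^sub>C b"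
    using assms by (simp add: u_def adj_add adj_scaleC scaleC_minus_left)
  have "adj u * u = a * a + b * b"
    unfolding au using assms(3) scaleC_minus_left[of 1 "b * b"]
    by (simp add: u_def algebra_simps scaleC_diff scaleC_add_right mult_scaleC_left mult_scaleC_right scaleC_scaleC scaleC_one)
  then have "(norm u)\<^sup>2 \<le> \<bar>r\<bar>"
    using norm_adj_mult[of u] norm_scaleR_one_le[of r, where 'a='a] assms(4) by simp
  moreover have "u + adj u = 2 *\<^sub>R a" unfolding au by (simp add: u_def scaleR_2)
  then have "2 * norm a \<le> norm u + norm (adj u)"
    using norm_triangle_ineq[of u "adj u"] by simp
  then have "norm a \<le> norm u" by simp
  ultimately show ?thesis by (meson norm_ge_zero order_trans power_mono)
qed

text \<open>With \<open>s\<close> the root of \<open>1 - a\<^sup>2\<close>, the element \<open>s + \<i> a\<close> is unitary, so its real part \<open>s\<close> is a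
  contraction; and \<open>1 - a\<^sup>2 = s\<^sup>2\<close>.\<close>

lemma norm_one_minus_square_le:
  fixes a :: "'a::unital_cstar_algebra"
  assumes a: "adj a = a" "norm a \<le> 1"
  shows "norm (1 - a * a) \<le> 1"
proof -
  have aa: "norm (a * a) \<le> 1" using a by (simp add: norm_square_selfadjoint power_le_one)
  have "adj (a * a) = a * a" by (simp add: adj_mult a(1))
  from root_one_minus[OF this aa] obtain s where s: "adj s = s" "s * s = 1 - a * a"
    "\<And>y. y * (a * a) = (a * a) * y \<Longrightarrow> y * s = s * y" by blast
  have "s * a = a * s" using s(3)[of a] by (simp add: mult.assoc)
  then have "(norm s)\<^sup>2 \<le> 1"
    using norm_le_of_circle[of s a 1] a s(1,2) by simp
  then show ?thesis using s(1,2) norm_square_selfadjoint[of s] by simp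
qed

lemma norm_minus_square_le:
  fixes a :: "'a::unital_cstar_algebra"
  assumes a: "adj a = a" "(norm a)\<^sup>2 \<le> t"
  shows "norm (t *\<^sub>R 1 - a * a) \<le> t"
proof (cases "t = 0")
  case True
  then show ?thesis using a by simp
next
  case False
  with a(2) have t: "t > 0" using zero_le_power2[of "norm a"] by linarith
  define b where "b = (1 / sqrt t) *\<^sub>R a"
  have "norm a \<le> sqrt t" using a(2) by (simp add: real_le_rsqrt)
  then have "norm b \<le> 1" using t by (simp add: b_def)
  moreover have "adj b = b" by (simp add: b_def adj_scaleR a(1))
  ultimately have "norm (t *\<^sub>R (1 - b * b)) \<le> t"
    using norm_one_minus_square_le[of b] t by simp
  then show ?thesis using t by (simp add: b_def scaleR_diff_right)
qed

lemma nonneg_square: "adj a = a \<Longrightarrow> nonneg (a * a)"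
  unfolding nonneg_def using norm_minus_square_le[of a "(norm a)\<^sup>2"] by (auto simp: adj_mult)

lemma nonneg_one [simp]: "nonneg 1"
  using nonneg_square[of 1] by simp

lemma nonneg_norm_minus_le:
  assumes "nonneg x" "norm x \<le> t" shows "norm (t *\<^sub>R 1 - x) \<le> t"
proof -
  from nonneg_root[OF assms(1)] obtain s where s: "nonneg s" "s * s = x" by metis
  then show ?thesis
    using norm_minus_square_le[of s t] assms(2) norm_square_selfadjoint[of s]
    by (auto dest: nonneg_selfadjoint)
qed

lemma nonneg_mult_commute:
  assumes "nonneg x" "nonneg y" "x * y = y * x"
  shows "nonneg (x * y)"
proof -
  from nonneg_root[OF assms(1)] obtain a where
    a: "nonneg a" "a * a = x" "\<And>z. z * x = x * z \<Longrightarrow> z * a = a * z" by blast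
  from nonneg_root[OF assms(2)] obtain b where
    b: "nonneg b" "b * b = y" "\<And>z. z * y = y * z \<Longrightarrow> z * b = b * z" by blast
  have "a * y = y * a" using a(3)[of y] assms(3) by simp
  then have ab: "a * b = b * a" using b(3) by simp
  have "adj (a * b) = a * b"
    using a(1) b(1) ab by (simp add: adj_mult nonneg_selfadjoint)
  moreover have "(a * b) * (a * b) = x * y"
    unfolding a(2)[symmetric] b(2)[symmetric] using ab by (metis mult.assoc)
  ultimately show ?thesis using nonneg_square by metis
qed

text \<open>The roots of \<open>x\<close> and of \<open>r - x\<close> commute, and their squares add up to \<open>r\<close>.\<close>

lemma norm_le_of_nonneg:
  fixes x :: "'a::unital_cstar_algebra"
  assumes x: "nonneg x" "nonneg (r *\<^sub>R 1 - x)" shows "norm x \<le> \<bar>r\<bar>"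
proof -
  from nonneg_root[OF x(1)] obtain a where
    a: "nonneg a" "a * a = x" "\<And>z. z * x = x * z \<Longrightarrow> z * a = a * z" by blast
  from nonneg_root[OF x(2)] obtain b where b: "nonneg b" "b * b = r *\<^sub>R 1 - x"
    "\<And>z. z * (r *\<^sub>R 1 - x) = (r *\<^sub>R 1 - x) * z \<Longrightarrow> z * b = b * z" by blast
  have "a * x = x * a" by (simp add: mult.assoc flip: a(2))
  then have "a * b = b * a"
    by (intro b(3)) (simp add: left_diff_distrib right_diff_distrib)
  then have "(norm a)\<^sup>2 \<le> \<bar>r\<bar>"
    using norm_le_of_circle[of a b r] a(1,2) b(1,2) by (simp add: nonneg_selfadjoint)
  then show ?thesis using a(1,2) norm_square_selfadjoint[of a] by (simp add: nonneg_selfadjoint)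
qed

text \<open>Apply the preceding bound to \<open>x \<le> x + y \<le> norm (x + y)\<close>.\<close>

lemma norm_mono_nonneg:
  assumes "nonneg x" "nonneg y" shows "norm x \<le> norm (x + y)"
proof -
  have "nonneg (norm (x + y) *\<^sub>R 1 - (x + y))"
    using assms by (intro nonneg_norm_minus nonneg_selfadjoint nonneg_add)
  from nonneg_add[OF this assms(2)] have "nonneg (norm (x + y) *\<^sub>R 1 - x)"
    by (simp add: algebra_simps)
  from norm_le_of_nonneg[OF assms(1) this] show ?thesis by simp
qed

lemma norm_le_scaleR_of_nonneg:
  assumes "nonneg x" "nonneg (c *\<^sub>R y - x)" "0 \<le> c" shows "norm x \<le> c * norm y"
  using norm_mono_nonneg[OF assms(1,2)] assms(3) by simp

text \<open>For a nonnegative element the bound in the definition holds with every \<open>t\<close> above its norm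
  (\<open>nonneg_norm_minus_le\<close>); with \<open>t = norm x + \<epsilon> norm y\<close> it survives the limit \<open>\<epsilon> \<longrightarrow> 0\<close>.\<close>

lemma nonneg_closed_segment:
  fixes x y :: "'a::unital_cstar_algebra"
  assumes h: "\<And>\<epsilon>. \<epsilon> > 0 \<Longrightarrow> nonneg (x + \<epsilon> *\<^sub>R y)" and x: "adj x = x"
  shows "nonneg x"
proof -
  have "norm (norm x *\<^sub>R 1 - x) \<le> norm x"
  proof (rule field_le_epsilon)
    fix e :: real assume e: "e > 0"
    \<comment> \<open>Three error terms of size \<open>\<epsilon> * norm y\<close> occur: one in the bound, and two in replacing \<open>x + \<epsilon> y\<close>
      by \<open>x\<close> and \<open>norm x + \<epsilon> norm y\<close> by \<open>norm x\<close>.\<close>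
    define \<epsilon> where "\<epsilon> = e / (3 * (norm y + 1))"
    have y1: "norm y + 1 > 0" using norm_ge_zero[of y] by linarith
    then have \<epsilon>: "\<epsilon> > 0" using e by (simp add: \<epsilon>_def)
    have "3 * (\<epsilon> * norm y) \<le> 3 * (\<epsilon> * (norm y + 1))" using \<epsilon> by simp
    also have "\<dots> = e" using y1 by (simp add: \<epsilon>_def field_simps)
    finally have small: "3 * (\<epsilon> * norm y) \<le> e" .
    let ?t = "norm x + \<epsilon> * norm y"
    have "norm (x + \<epsilon> *\<^sub>R y) \<le> ?t"
      using norm_triangle_ineq[of x "\<epsilon> *\<^sub>R y"] \<epsilon> by simp
    then have 1: "norm (?t *\<^sub>R 1 - (x + \<epsilon> *\<^sub>R y)) \<le> ?t"
      by (rule nonneg_norm_minus_le[OF h[OF \<epsilon>]])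
    have 2: "norm ((\<epsilon> * norm y) *\<^sub>R (1 :: 'a)) \<le> \<epsilon> * norm y"
      using norm_scaleR_one_le[of "\<epsilon> * norm y", where 'a='a] \<epsilon> by simp
    have "norm x *\<^sub>R 1 - x
        = (?t *\<^sub>R 1 - (x + \<epsilon> *\<^sub>R y)) + (\<epsilon> *\<^sub>R y - (\<epsilon> * norm y) *\<^sub>R 1)"
      by (simp add: algebra_simps)
    then have "norm (norm x *\<^sub>R 1 - x)
        \<le> norm (?t *\<^sub>R 1 - (x + \<epsilon> *\<^sub>R y)) + norm (\<epsilon> *\<^sub>R y - (\<epsilon> * norm y) *\<^sub>R 1)"
      using norm_triangle_ineq by metis
    moreover have "norm (\<epsilon> *\<^sub>R y - (\<epsilon> * norm y) *\<^sub>R 1)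
        \<le> \<epsilon> * norm y + norm ((\<epsilon> * norm y) *\<^sub>R (1 :: 'a))"
      using norm_triangle_ineq4[of "\<epsilon> *\<^sub>R y" "(\<epsilon> * norm y) *\<^sub>R 1"] \<epsilon> by simp
    ultimately show "norm (norm x *\<^sub>R 1 - x) \<le> norm x + e"
      using 1 2 small by linarith
  qed
  then show ?thesis using x by (auto simp: nonneg_def)
qed


section \<open>Positivity of \<open>y* y\<close>\<close>

text \<open>\<open>z* z + z z*\<close> is a sum of two squares, so \<open>x = z z*\<close> is nonnegative; put \<open>q = - z* z\<close> and
  \<open>m = (norm z)\<^sup>2\<close>. Since \<open>(m + x) z = z (m - q)\<close> and \<open>m - q\<close> has norm at most \<open>m\<close>,
  \<open>(m + x) x (m + x)\<close> has norm at most \<open>m\<^sup>3\<close>; but it dominates \<open>2 m x\<^sup>2\<close>, which has norm \<open>2 m\<^sup>3\<close>.\<close>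

lemma adj_mult_self_nonpos:
  fixes z :: "'a::unital_cstar_algebra"
  assumes q: "nonneg (- (adj z * z))" shows "z = 0"
proof -
  define x where "x = z * adj z"
  define m where "m = (norm z)\<^sup>2"
  \<comment> \<open>\<open>(z + z*)\<^sup>2 + k\<^sup>2 = 2 (z* z + z z*)\<close>\<close>
  define k where "k = \<i> *\<^sub>C (z - adj z)"
  have "adj (z + adj z) = z + adj z" by (simp add: adj_add adj_adj add.commute)
  then have 1: "nonneg ((z + adj z) * (z + adj z))" by (rule nonneg_square)
  have "adj k = k"
    by (simp add: k_def adj_scaleC adj_diff adj_adj scaleC_minus_left scaleC_diff)
  then have "nonneg (k * k)" by (rule nonneg_square)
  moreover have "k * k = - ((z - adj z) * (z - adj z))"
    using scaleC_minus_left[of 1 "(z - adj z) * (z - adj z)"]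
    by (simp add: k_def mult_scaleC_left mult_scaleC_right scaleC_scaleC scaleC_one)
  ultimately have "nonneg ((z + adj z) * (z + adj z) - (z - adj z) * (z - adj z))"
    using nonneg_add[OF 1] by fastforce
  also have "(z + adj z) * (z + adj z) - (z - adj z) * (z - adj z) = 2 *\<^sub>R (adj z * z + x)"
    by (simp add: x_def algebra_simps scaleR_2)
  finally have "nonneg ((1/2) *\<^sub>R 2 *\<^sub>R (adj z * z + x))" by (rule nonneg_scaleR) simp
  then have "nonneg (adj z * z + x)" by simp
  from nonneg_add[OF this q] have x: "nonneg x" by simp
  have m: "m \<ge> 0" "norm (- (adj z * z)) = m" "norm x = m"
    by (simp_all add: m_def x_def norm_adj_mult norm_mult_adj)
  have nq: "norm (m *\<^sub>R 1 + adj z * z) \<le> m"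
    using nonneg_norm_minus_le[OF q, of m] m by simp
  define g where "g = (m *\<^sub>R 1 + x) * z"
  have "g = z * (m *\<^sub>R 1 + adj z * z)"
    by (simp add: g_def x_def algebra_simps)
  then have "norm g \<le> norm z * m"
    using norm_mult_ineq[of z "m *\<^sub>R 1 + adj z * z"] mult_left_mono[OF nq, of "norm z"] by simp
  then have "(norm g)\<^sup>2 \<le> (norm z * m)\<^sup>2" by (simp add: power_mono)
  then have "norm (g * adj g) \<le> m * (m * m)"
    unfolding norm_mult_adj by (simp add: m_def power2_eq_square mult.assoc mult.left_commute)
  moreover have "g * adj g = (2 * m) *\<^sub>R (x * x) + ((m * m) *\<^sub>R x + x * (x * x))"
  proof -
    have "g * adj g = (m *\<^sub>R 1 + x) * x * (m *\<^sub>R 1 + x)"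
      unfolding g_def adj_mult adj_add adj_scaleR adj_one nonneg_selfadjoint[OF x]
      by (simp add: x_def mult.assoc)
    then show ?thesis by (simp add: algebra_simps flip: scaleR_left_distrib)
  qed
  moreover have xx: "nonneg (x * x)" using x by (simp add: nonneg_square nonneg_selfadjoint)
  then have "norm ((2 * m) *\<^sub>R (x * x))
      \<le> norm ((2 * m) *\<^sub>R (x * x) + ((m * m) *\<^sub>R x + x * (x * x)))"
    using x m(1) by (intro norm_mono_nonneg nonneg_add nonneg_scaleR nonneg_mult_commute)
      (simp_all add: mult.assoc)
  moreover have "norm ((2 * m) *\<^sub>R (x * x)) = 2 * (m * (m * m))"
    using m x norm_square_selfadjoint[of x] by (simp add: nonneg_selfadjoint power2_eq_square)
  ultimately have "2 * (m * (m * m)) \<le> m * (m * m)" by (metis order_trans)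
  then have "m * (m * m) \<le> 0" by linarith
  then have "m = 0" using m(1) by (metis mult_nonneg_nonneg mult_eq_0_iff order_antisym)
  then show ?thesis by (simp add: m_def)
qed

text \<open>Let \<open>a = y* y\<close> and \<open>b = \<bar>a\<bar>\<close>, the root of \<open>a\<^sup>2\<close>; then \<open>f = b - a\<close> is twice the negative part of \<open>a\<close>.
  As \<open>a f = - b f\<close>, the element \<open>z = y f\<close> has \<open>z* z = - b f\<^sup>2 \<le> 0\<close>, whence \<open>z = 0\<close> and \<open>f = 0\<close>.\<close>

theorem nonneg_adj_mult:
  fixes y :: "'a::unital_cstar_algebra"
  shows "nonneg (adj y * y)"
proof -
  define a where "a = adj y * y"
  have a: "adj a = a" by (simp add: a_def adj_mult adj_adj)
  from nonneg_root[OF nonneg_square[OF a]] obtain b where b: "nonneg b" "b * b = a * a"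
    "\<And>x. x * (a * a) = (a * a) * x \<Longrightarrow> x * b = b * x" by blast
  from nonneg_root[OF b(1)] obtain c where c: "nonneg c" "c * c = b"
    "\<And>x. x * b = b * x \<Longrightarrow> x * c = c * x" by blast
  have ab: "a * b = b * a" using b(3)[of a] by (simp add: mult.assoc)
  have ac: "a * c = c * a" using c(3) ab by simp
  have bc: "b * c = c * b" using c(3)[of b] by simp
  define f where "f = b - a"
  have f: "adj f = f" using a b(1) by (simp add: f_def adj_diff nonneg_selfadjoint)
  have cf: "c * f = f * c" using ac bc by (simp add: f_def algebra_simps)
  have "a * f = - (b * f)" using ab b(2) by (simp add: f_def algebra_simps)
  then have "f * (a * f) = - (f * (c * (c * f)))" by (simp add: mult.assoc flip: c(2))
  also have "\<dots> = - ((c * f) * (c * f))" by (metis cf mult.assoc)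
  finally have z: "adj (y * f) * (y * f) = - ((c * f) * (c * f))"
    by (simp add: adj_mult f a_def mult.assoc)
  have "adj (c * f) = c * f" using c(1) f cf by (simp add: adj_mult nonneg_selfadjoint)
  then have "nonneg ((c * f) * (c * f))" by (rule nonneg_square)
  then have "y * f = 0" using adj_mult_self_nonpos[of "y * f"] z by simp
  then have "a * f = 0" by (simp add: a_def mult.assoc)
  then have "b * f = 0" using \<open>a * f = - (b * f)\<close> by simp
  then have "f * f = 0" using \<open>a * f = 0\<close> by (simp add: f_def left_diff_distrib)
  then have "f = 0" using norm_square_selfadjoint[OF f] by simp
  then show ?thesis using b(1) by (simp add: f_def a_def)
qed

lemma nonneg_mult_adj: "nonneg (y * adj y)"
  using nonneg_adj_mult[of "adj y"] by (simp add: adj_adj)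

lemma nonneg_iff_positive: "nonneg x \<longleftrightarrow> positive x"
proof
  assume x: "nonneg x"
  then obtain s where "nonneg s" "s * s = x" using nonneg_root by blast
  then show "positive x" unfolding positive_def by (metis nonneg_selfadjoint)
qed (auto simp: positive_def nonneg_adj_mult)

lemma nonneg_conj: "nonneg x \<Longrightarrow> nonneg (y * x * adj y)"
proof -
  assume "nonneg x"
  then obtain s where s: "nonneg s" "s * s = x" using nonneg_root by blast
  then have "y * x * adj y = (y * s) * adj (y * s)"
    by (simp add: adj_mult nonneg_selfadjoint mult.assoc flip: s(2))
  then show ?thesis by (simp add: nonneg_mult_adj)
qed

lemma star_hom_nonneg: "star_hom f \<Longrightarrow> nonneg x \<Longrightarrow> nonneg (f x)"
  unfolding nonneg_iff_positive positive_def star_hom_def by metis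


section \<open>Positive matrices under an embedding\<close>

text \<open>For \<open>t\<close> with \<open>norm (t - x) \<le> t\<close>, the element \<open>(x + \<epsilon>) / (t + \<epsilon>)\<close> has distance less than \<open>1\<close> from
  the unit; its left inverse is the fixed point of a contraction, and the inverse is two-sided since
  \<open>x + \<epsilon>\<close> is self-adjoint.\<close>

lemma inverse_nonneg_plus:
  fixes x :: "'a::unital_cstar_algebra"
  assumes x: "nonneg x" and \<epsilon>: "\<epsilon> > 0"
  obtains d where "adj d = d" "d * (x + \<epsilon> *\<^sub>R 1) = 1"
proof -
  obtain t where t: "norm (t *\<^sub>R 1 - x) \<le> t" using x by (auto simp: nonneg_def)
  then have t0: "t \<ge> 0" by (rule order_trans[OF norm_ge_zero])
  define T where "T = t + \<epsilon>"
  have T: "T > 0" using t0 \<epsilon> by (simp add: T_def)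
  define q where "q = x + \<epsilon> *\<^sub>R 1"
  have q: "adj q = q" using x by (simp add: q_def adj_add adj_scaleR nonneg_selfadjoint)
  define h where "h = 1 - (1/T) *\<^sub>R q"
  have "h = (1/T) *\<^sub>R (T *\<^sub>R 1 - q)" using T by (simp add: h_def scaleR_diff_right)
  also have "T *\<^sub>R 1 - q = t *\<^sub>R 1 - x" by (simp add: T_def q_def algebra_simps)
  finally have "norm h \<le> t / T" using t T by (simp add: divide_right_mono)
  moreover have "t / T < 1" using T \<epsilon> by (simp add: T_def)
  ultimately have h: "norm h < 1" by simp
  define f where "f d = d * h + (1/T) *\<^sub>R 1" for d
  have "dist (f d) (f e) \<le> norm h * dist d e" for d e
    using norm_mult_ineq[of "d - e" h]
    by (simp add: f_def dist_norm left_diff_distrib mult.commute)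
  then obtain d where "f d = d"
    using banach_fix_type[of "norm h" f] h by auto
  then have "(1/T) *\<^sub>R (d * q) = (1/T) *\<^sub>R 1"
    by (simp add: f_def h_def right_diff_distrib)
  then have dq: "d * q = 1" using T by simp
  have "adj (d * q) = 1" by (simp add: dq)
  then have qd: "q * adj d = 1" unfolding adj_mult q .
  have "d = d * (q * adj d)" by (simp add: qd)
  also have "\<dots> = adj d" by (simp add: dq flip: mult.assoc)
  finally show thesis using that[of d] dq by (simp add: q_def)
qed

lemma star_hom_simps:
  assumes "star_hom f"
  shows "f (x + y) = f x + f y" "f (x * y) = f x * f y" "f (adj x) = adj (f x)"
    "f (c *\<^sub>C x) = c *\<^sub>C f x" "f 0 = 0" "f (- x) = - f x" "f (x - y) = f x - f y"
    "f (sum g S) = (\<Sum>i\<in>S. f (g i))"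
proof -
  show add: "f (x + y) = f x + f y" for x y using assms by (simp add: star_hom_def)
  show "f (x * y) = f x * f y" "f (adj x) = adj (f x)" "f (c *\<^sub>C x) = c *\<^sub>C f x"
    using assms by (simp_all add: star_hom_def)
  show z: "f 0 = 0" using add[of 0 0] by simp
  show m: "f (- x) = - f x" for x using add[of "- x" x] z by (simp add: eq_neg_iff_add_eq_0)
  show "f (x - y) = f x - f y" using add[of x "- y"] m by simp
  show "f (sum g S) = (\<Sum>i\<in>S. f (g i))"
    by (induction S rule: infinite_finite_induct) (simp_all add: z add)
qed

lemma star_hom_scaleR:
  fixes f :: "'a::unital_cstar_algebra \<Rightarrow> 'b::unital_cstar_algebra"
  shows "star_hom f \<Longrightarrow> f (r *\<^sub>R x) = r *\<^sub>R f x"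
  by (simp add: scaleR_scaleC star_hom_simps)

definition matrix_form :: "nat \<Rightarrow> (nat \<Rightarrow> nat \<Rightarrow> 'a::unital_star_algebra) \<Rightarrow> (nat \<Rightarrow> 'a) \<Rightarrow> 'a" where
  "matrix_form n Q t = (\<Sum>i<n. \<Sum>j<n. t i * Q i j * adj (t j))"

lemma matrix_form_Suc:
  "matrix_form (Suc n) Q t = matrix_form n Q t + (\<Sum>i<n. t i * Q i n) * adj (t n)
     + t n * (\<Sum>j<n. Q n j * adj (t j)) + t n * Q n n * adj (t n)"
  by (simp add: matrix_form_def sum.distrib sum_distrib_left sum_distrib_right mult.assoc add.assoc)

lemma adj_matrix_form:
  assumes "\<And>i j. adj (Q i j) = Q j i"
  shows "adj (matrix_form n Q t) = matrix_form n Q t"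
  unfolding matrix_form_def adj_sum adj_mult adj_adj assms
  by (subst sum.swap) (simp add: mult.assoc)

lemma matrix_form_Schur_complement:
  "matrix_form n (\<lambda>i j. Q i j - Q i n * d * Q n j) t
     = matrix_form n Q t - (\<Sum>i<n. t i * Q i n) * d * (\<Sum>j<n. Q n j * adj (t j))"
  by (simp add: matrix_form_def right_diff_distrib left_diff_distrib sum_subtractf
      sum_distrib_right[where r = d] sum_product mult.assoc)

text \<open>A matrix \<open>Q\<close> over \<open>A\<close> that is positive against rows from \<open>A\<close> is a positive element of \<open>M\<^sub>n(A)\<close>, so
  it stays positive against rows from a larger algebra. This is shown by Gaussian elimination: the last
  diagonal entry, made invertible by adding \<open>\<epsilon>\<close>, serves as the pivot \<open>q\<close>; the form is then a term
  \<open>s q s*\<close> plus the form of the Schur complement, which is again positive over \<open>A\<close>.\<close>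

lemma nonneg_matrix_form_embedding:
  fixes \<iota> :: "'a::unital_cstar_algebra \<Rightarrow> 'b::unital_cstar_algebra"
  assumes \<iota>: "star_hom \<iota>" "\<iota> 1 = 1"
  assumes "\<And>i j. adj (Q i j) = Q j i" and "\<And>a. nonneg (matrix_form n Q a)"
  shows "nonneg (matrix_form n (\<lambda>i j. \<iota> (Q i j)) t)"
  using assms(3,4)
proof (induction n arbitrary: Q)
  case 0
  show ?case by (simp add: matrix_form_def)
next
  case (Suc n)
  note herm = Suc.prems(1) and pos = Suc.prems(2)
  have corner: "nonneg (Q n n)"
    using pos[of "\<lambda>i. if i = n then 1 else 0"] by (simp add: matrix_form_Suc, simp add: matrix_form_def)
  have herm\<iota>: "adj (\<iota> (Q i j)) = \<iota> (Q j i)" for i j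
    using herm by (simp flip: star_hom_simps(3)[OF \<iota>(1)])
  show ?case
  proof (rule nonneg_closed_segment)
    show "adj (matrix_form (Suc n) (\<lambda>i j. \<iota> (Q i j)) t) = matrix_form (Suc n) (\<lambda>i j. \<iota> (Q i j)) t"
      by (rule adj_matrix_form) (rule herm\<iota>)
    fix \<epsilon> :: real assume \<epsilon>: "\<epsilon> > 0"
    define q where "q = Q n n + \<epsilon> *\<^sub>R 1"
    obtain d where d: "adj d = d" "d * q = 1"
      using inverse_nonneg_plus[OF corner \<epsilon>] unfolding q_def by blast
    define S where "S i j = Q i j - Q i n * d * Q n j" for i j
    have "adj (S i j) = S j i" for i j
      by (simp add: S_def adj_diff adj_mult herm d(1) mult.assoc)
    moreover have "nonneg (matrix_form n S a)" for a
    proof -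
      define \<beta> where "\<beta> = (\<Sum>i<n. a i * Q i n)"
      \<comment> \<open>The last entry that minimises the form with \<open>q\<close> in the corner: completing the square leaves
        exactly the Schur complement.\<close>
      define \<alpha> where "\<alpha> = - (\<beta> * d)"
      have \<beta>': "(\<Sum>j<n. Q n j * adj (a j)) = adj \<beta>"
        by (simp add: \<beta>_def adj_sum adj_mult herm)
      have "matrix_form (Suc n) Q (a(n := \<alpha>))
          = matrix_form n Q a + \<beta> * adj \<alpha> + \<alpha> * adj \<beta> + \<alpha> * Q n n * adj \<alpha>"
        unfolding matrix_form_Suc \<beta>_def \<beta>'[symmetric, unfolded \<beta>_def] by (simp add: matrix_form_def)
      moreover have "\<alpha> * Q n n * adj \<alpha> + \<epsilon> *\<^sub>R (\<alpha> * adj \<alpha>) = \<alpha> * q * adj \<alpha>"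
        by (simp add: q_def algebra_simps)
      moreover have "\<alpha> * q = - \<beta>" by (simp add: \<alpha>_def d(2) mult.assoc)
      moreover have "matrix_form n S a = matrix_form n Q a + \<alpha> * adj \<beta>"
        unfolding S_def matrix_form_Schur_complement by (simp add: \<alpha>_def \<beta>_def \<beta>'[unfolded \<beta>_def])
      ultimately have "matrix_form n S a = matrix_form (Suc n) Q (a(n := \<alpha>)) + \<epsilon> *\<^sub>R (\<alpha> * adj \<alpha>)"
        by (simp add: add.assoc)
      then show ?thesis
        using pos \<epsilon> by (simp add: nonneg_add nonneg_scaleR nonneg_mult_adj)
    qed
    ultimately have S: "nonneg (matrix_form n (\<lambda>i j. \<iota> (S i j)) t)"
      by (rule Suc.IH)
    define \<beta> where "\<beta> = (\<Sum>i<n. t i * \<iota> (Q i n))"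
    have \<beta>': "(\<Sum>j<n. \<iota> (Q n j) * adj (t j)) = adj \<beta>"
      by (simp add: \<beta>_def adj_sum adj_mult herm\<iota>)
    have "nonneg q" using \<epsilon> by (simp add: q_def corner nonneg_add nonneg_scaleR)
    then have "nonneg ((t n + \<beta> * \<iota> d) * \<iota> q * adj (t n + \<beta> * \<iota> d))"
      by (intro nonneg_conj star_hom_nonneg[OF \<iota>(1)])
    from nonneg_add[OF S this]
    have "nonneg (matrix_form n (\<lambda>i j. \<iota> (S i j)) t
      + (t n + \<beta> * \<iota> d) * \<iota> q * adj (t n + \<beta> * \<iota> d))" .
    also have "matrix_form n (\<lambda>i j. \<iota> (S i j)) t
        = matrix_form n (\<lambda>i j. \<iota> (Q i j)) t - \<beta> * \<iota> d * adj \<beta>"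
      using matrix_form_Schur_complement[of n "\<lambda>i j. \<iota> (Q i j)" "\<iota> d" t]
      by (simp add: S_def star_hom_simps[OF \<iota>(1)] \<beta>_def[symmetric] \<beta>')
    also have "(t n + \<beta> * \<iota> d) * \<iota> q * adj (t n + \<beta> * \<iota> d)
        = t n * \<iota> (Q n n) * adj (t n) + \<epsilon> *\<^sub>R (t n * adj (t n))
          + t n * adj \<beta> + \<beta> * adj (t n) + \<beta> * \<iota> d * adj \<beta>"
    proof -
      have "adj (d * q) = 1" by (simp add: d(2))
      then have "q * d = 1"
        using d(1) nonneg_selfadjoint[OF \<open>nonneg q\<close>] by (simp add: adj_mult)
      then have qd: "\<iota> q * \<iota> d = 1" and dq: "\<iota> d * \<iota> q = 1" and ad: "adj (\<iota> d) = \<iota> d"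
        using d \<iota> star_hom_simps(2,3)[OF \<iota>(1)] by metis+
      have "\<beta> * \<iota> d * \<iota> q = \<beta>" "t n * \<iota> q * \<iota> d = t n"
        by (simp_all add: dq qd mult.assoc)
      then have "(t n + \<beta> * \<iota> d) * \<iota> q * adj (t n + \<beta> * \<iota> d)
          = t n * \<iota> q * adj (t n) + t n * adj \<beta> + \<beta> * adj (t n) + \<beta> * \<iota> d * adj \<beta>"
        by (simp add: distrib_left distrib_right adj_add adj_mult ad add.assoc flip: mult.assoc)
      also have "t n * \<iota> q * adj (t n) = t n * \<iota> (Q n n) * adj (t n) + \<epsilon> *\<^sub>R (t n * adj (t n))"
        by (simp add: q_def star_hom_simps[OF \<iota>(1)] star_hom_scaleR[OF \<iota>(1)] \<iota>(2)
            distrib_left distrib_right)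
      finally show ?thesis .
    qed
    finally show "nonneg (matrix_form (Suc n) (\<lambda>i j. \<iota> (Q i j)) t + \<epsilon> *\<^sub>R (t n * adj (t n)))"
      by (simp add: matrix_form_Suc \<beta>_def[symmetric] \<beta>' algebra_simps)
  qed
qed


section \<open>The componentwise extension of a bounded linear map\<close>

lemma seq_algebra_cases:
  obtains x where "X = abs_seq_algebra x" "Bseq x"
proof
  show "X = abs_seq_algebra (rep_seq_algebra X)"
    by (simp add: Quotient3_abs_rep[OF Quotient3_seq_algebra])
  show "Bseq (rep_seq_algebra X)"
    using Quotient3_rep_reflp[OF Quotient3_seq_algebra, of X] by (simp add: seq_rel_def)
qed

lemma abs_seq_plus:
  "Bseq x \<Longrightarrow> Bseq y \<Longrightarrow> abs_seq_algebra x + abs_seq_algebra y = abs_seq_algebra (\<lambda>m. x m + y m)"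
  by (rule plus_seq_algebra.abs_eq) (simp_all add: seq_rel_def)

lemma abs_seq_times:
  "Bseq x \<Longrightarrow> Bseq y \<Longrightarrow> abs_seq_algebra x * abs_seq_algebra y = abs_seq_algebra (\<lambda>m. x m * y m)"
  by (rule times_seq_algebra.abs_eq) (simp_all add: seq_rel_def)

lemma abs_seq_adj: "Bseq x \<Longrightarrow> adj (abs_seq_algebra x) = abs_seq_algebra (\<lambda>m. adj (x m))"
  by (rule adj_seq_algebra.abs_eq) (simp add: seq_rel_def)

lemma abs_seq_scaleC: "Bseq x \<Longrightarrow> c *\<^sub>C abs_seq_algebra x = abs_seq_algebra (\<lambda>m. c *\<^sub>C x m)"
  by (rule scaleC_seq_algebra.abs_eq) (simp add: seq_rel_def)

lemma abs_seq_eq_iff: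
  "Bseq x \<Longrightarrow> Bseq y \<Longrightarrow> abs_seq_algebra x = abs_seq_algebra y \<longleftrightarrow> (\<lambda>m. x m - y m) \<longlonglongrightarrow> 0"
  using Quotient3_rel[OF Quotient3_seq_algebra, of x y] by (auto simp: seq_rel_def)

lemma abs_seq_eq_0_iff: "Bseq x \<Longrightarrow> abs_seq_algebra x = 0 \<longleftrightarrow> x \<longlonglongrightarrow> 0"
  using abs_seq_eq_iff[of x "\<lambda>_. 0"] by (simp add: zero_seq_algebra_def)

lemma Bseq_adj: "Bseq x \<Longrightarrow> Bseq (\<lambda>m. adj (x m :: 'a::unital_cstar_algebra))"
  by (simp add: Bseq_def)

lemma abs_seq_sum:
  assumes "\<And>i. i \<in> S \<Longrightarrow> Bseq (x i)"
  shows "Bseq (\<lambda>m. \<Sum>i\<in>S. x i m)"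
    "(\<Sum>i\<in>S. abs_seq_algebra (x i)) = abs_seq_algebra (\<lambda>m. \<Sum>i\<in>S. x i m)"
proof -
  have "Bseq (\<lambda>m. \<Sum>i\<in>S. x i m)
      \<and> (\<Sum>i\<in>S. abs_seq_algebra (x i)) = abs_seq_algebra (\<lambda>m. \<Sum>i\<in>S. x i m)"
    using assms
    by (induction S rule: infinite_finite_induct)
      (simp_all add: zero_seq_algebra_def Bseq_plus abs_seq_plus)
  then show "Bseq (\<lambda>m. \<Sum>i\<in>S. x i m)"
    "(\<Sum>i\<in>S. abs_seq_algebra (x i)) = abs_seq_algebra (\<lambda>m. \<Sum>i\<in>S. x i m)" by auto
qed

lemma const_seq_abs: "const_seq a = abs_seq_algebra (\<lambda>_. a)"
  by (simp add: const_seq_def)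

lemma const_seq_simps:
  "const_seq (x + y) = const_seq x + const_seq y" "const_seq (x * y) = const_seq x * const_seq y"
  "const_seq (adj x) = adj (const_seq x)" "const_seq (c *\<^sub>C x) = c *\<^sub>C const_seq x"
  "const_seq 1 = 1" "const_seq 0 = 0"
  by (simp_all add: const_seq_abs abs_seq_plus abs_seq_times abs_seq_adj abs_seq_scaleC
      one_seq_algebra_def zero_seq_algebra_def)

lemma const_seq_sum: "const_seq (sum f S) = (\<Sum>i\<in>S. const_seq (f i))"
  by (induction S rule: infinite_finite_induct) (simp_all add: const_seq_simps)

lemma const_seq_inject: "const_seq x = const_seq y \<longleftrightarrow> x = y"
  by (simp add: const_seq_abs abs_seq_eq_iff LIMSEQ_const_iff)

lemma Bseq_bounded_linear:
  assumes f: "bounded_linear f" and "Bseq x" shows "Bseq (\<lambda>m. f (x m))"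
proof -
  obtain K where K: "K > 0" "\<And>a. norm (f a) \<le> norm a * K"
    using bounded_linear.pos_bounded[OF f] by blast
  obtain L where L: "\<forall>m. norm (x m) \<le> L" using assms(2) by (rule BseqE)
  have "norm (f (x m)) \<le> L * K" for m
    using K(2)[of "x m"] mult_right_mono[OF spec[OF L, of m], of K] K(1) by linarith
  then show ?thesis by (rule BseqI')
qed

lemma seq_map_const: "bounded_linear f \<Longrightarrow> seq_map f (const_seq a) = const_seq (f a)"
  by (simp add: const_seq_abs seq_map_abs)

lemma seq_map_add: "bounded_linear f \<Longrightarrow> seq_map f (X + Y) = seq_map f X + seq_map f Y"
  by (cases X rule: seq_algebra_cases; cases Y rule: seq_algebra_cases)
    (simp add: abs_seq_plus seq_map_abs Bseq_plus Bseq_bounded_linear linear_add[OF bounded_linear.linear])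

lemma seq_map_scaleC:
  assumes "bounded_linear f" "\<And>x. f (c *\<^sub>C x) = c *\<^sub>C f x"
  shows "seq_map f (c *\<^sub>C X) = c *\<^sub>C seq_map f X"
  by (cases X rule: seq_algebra_cases)
    (simp add: assms abs_seq_scaleC seq_map_abs Bseq_scaleC Bseq_bounded_linear)

lemma seq_map_adj:
  assumes "bounded_linear f" "\<And>x. f (adj x) = adj (f x)"
  shows "seq_map f (adj X) = adj (seq_map f X)"
  by (cases X rule: seq_algebra_cases)
    (simp add: assms abs_seq_adj seq_map_abs Bseq_adj Bseq_bounded_linear)

lemma seq_map_sum:
  assumes f: "bounded_linear f" shows "seq_map f (sum g S) = (\<Sum>i\<in>S. seq_map f (g i))"
proof -
  have "seq_map f 0 = 0"
    using seq_map_const[OF f, of 0] by (simp add: const_seq_simps linear_0[OF bounded_linear.linear[OF f]])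
  then show ?thesis
    by (induction S rule: infinite_finite_induct) (simp_all add: seq_map_add[OF f])
qed


section \<open>Expectations of finite index\<close>

locale finite_index_expectation =
  fixes \<iota> :: "'a::unital_cstar_algebra \<Rightarrow> 'b::unital_cstar_algebra" and E :: "'b \<Rightarrow> 'a"
    and n :: nat and u v :: "nat \<Rightarrow> 'b"
  assumes inclusion: "unital_inclusion \<iota>"
    and expectation: "conditional_expectation \<iota> E"
    and basis: "quasi_basis \<iota> E n u v"
begin

lemma hom: "star_hom \<iota>" and \<iota>_one [simp]: "\<iota> 1 = 1" and norm_\<iota> [simp]: "norm (\<iota> a) = norm a"
  using inclusion by (simp_all add: unital_inclusion_def)

lemma E_simps:
  "E (x + y) = E x + E y" "E (c *\<^sub>C x) = c *\<^sub>C E x" "E (\<iota> a) = a"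
  "E (\<iota> a * x) = a * E x" "E (x * \<iota> a) = E x * a"
  using expectation by (simp_all add: conditional_expectation_def)

lemma bounded_linear_\<iota>: "bounded_linear \<iota>"
  by (rule bounded_linear_intro[where K = 1])
    (simp_all add: star_hom_simps[OF hom] star_hom_scaleR[OF hom])

lemma bounded_linear_E: "bounded_linear E"
  using expectation by (intro bounded_linear_intro[where K = 1])
    (simp_all add: E_simps scaleR_scaleC conditional_expectation_def)

lemmas E_linear = linear_0[OF bounded_linear.linear[OF bounded_linear_E]]
  linear_diff[OF bounded_linear.linear[OF bounded_linear_E]]
  linear_scale[OF bounded_linear.linear[OF bounded_linear_E]]
  linear_sum[OF bounded_linear.linear[OF bounded_linear_E]]

lemma E_one [simp]: "E 1 = 1"
  using E_simps(3)[of 1] by simp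

lemma nonneg_E: "nonneg x \<Longrightarrow> nonneg (E x)"
  using expectation by (simp add: nonneg_iff_positive conditional_expectation_def)

text \<open>A self-adjoint \<open>s\<close> is a difference of nonnegative elements: \<open>4 s = (s + 1)\<^sup>2 - (s - 1)\<^sup>2\<close>.\<close>

lemma E_adj: "E (adj x) = adj (E x)"
proof -
  have sa: "adj (E s) = E s" if s: "adj s = s" for s
  proof -
    have "nonneg ((s + 1) * (s + 1))" "nonneg ((s - 1) * (s - 1))"
      using s by (auto intro!: nonneg_square simp: adj_add adj_diff)
    then have "adj (E ((s + 1) * (s + 1) - (s - 1) * (s - 1)))
        = E ((s + 1) * (s + 1) - (s - 1) * (s - 1))"
      by (simp add: E_linear adj_diff nonneg_selfadjoint nonneg_E)
    moreover have "(s + 1) * (s + 1) - (s - 1) * (s - 1) = 4 *\<^sub>R s"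
    proof -
      have "(s + 1) * (s + 1) - (s - 1) * (s - 1) = 2 *\<^sub>R s + 2 *\<^sub>R s"
        by (simp add: algebra_simps scaleR_2)
      then show ?thesis by (simp flip: scaleR_left_distrib)
    qed
    ultimately show ?thesis by (simp add: E_linear adj_scaleR)
  qed
  \<comment> \<open>Twice the real part, and minus twice the imaginary part, of \<open>x\<close>.\<close>
  define h where "h = x + adj x"
  define k where "k = \<i> *\<^sub>C (x - adj x)"
  have h: "adj h = h" by (simp add: h_def adj_add adj_adj add.commute)
  have k: "adj k = k"
    by (simp add: k_def adj_scaleC adj_diff adj_adj scaleC_minus_left scaleC_diff)
  have ik: "\<i> *\<^sub>C k = adj x - x"
    using scaleC_minus_left[of 1 "x - adj x"] by (simp add: k_def scaleC_scaleC scaleC_one)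
  have "2 *\<^sub>R adj x = h + \<i> *\<^sub>C k" "2 *\<^sub>R x = h - \<i> *\<^sub>C k"
    by (simp_all add: ik h_def scaleR_2)
  then have "2 *\<^sub>R E (adj x) = E h + \<i> *\<^sub>C E k" "2 *\<^sub>R E x = E h - \<i> *\<^sub>C E k"
    by (simp_all add: E_simps E_linear flip: E_linear(3))
  moreover from this(2) have "2 *\<^sub>R adj (E x) = E h + \<i> *\<^sub>C E k"
    using sa[OF h] sa[OF k] by (simp add: adj_diff adj_scaleC scaleC_minus_left flip: adj_scaleR)
  ultimately have "2 *\<^sub>R E (adj x) = 2 *\<^sub>R adj (E x)" by simp
  then show ?thesis by simp
qed

text \<open>Taking adjoints exchanges the two reconstruction formulas. Besides making the index self-adjoint,
  this gives the reconstruction formulas that evaluate the sums in \<open>sum_defect\<close> below.\<close>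

lemma quasi_basis_adj: "quasi_basis \<iota> E n (\<lambda>j. adj (v j)) (\<lambda>j. adj (u j))"
proof -
  have b1: "x = (\<Sum>j<n. u j * \<iota> (E (v j * x)))" and b2: "x = (\<Sum>j<n. \<iota> (E (x * u j)) * v j)" for x
    using basis by (simp_all add: quasi_basis_def)
  have "x = (\<Sum>j<n. adj (v j) * \<iota> (E (adj (u j) * x)))" for x
    using arg_cong[OF b2[of "adj x"], where f = adj]
    by (simp add: adj_sum adj_mult adj_adj flip: star_hom_simps(3)[OF hom] E_adj)
  moreover have "x = (\<Sum>j<n. \<iota> (E (x * adj (v j))) * adj (u j))" for x
    using arg_cong[OF b1[of "adj x"], where f = adj]
    by (simp add: adj_sum adj_mult adj_adj flip: star_hom_simps(3)[OF hom] E_adj)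
  ultimately show ?thesis unfolding quasi_basis_def by blast
qed

abbreviation ind :: 'b where "ind \<equiv> watatani_index \<iota> E"

lemma ind_sum_adj: "(\<Sum>j<n. adj (v j) * adj (u j)) = ind"
  using watatani_index_eq[OF quasi_basis_adj] by simp

lemma adj_ind [simp]: "adj ind = ind"
  using ind_sum_adj by (simp add: watatani_index_eq[OF basis] adj_sum adj_mult)

lemma ind_central: "x * ind = ind * x"
proof -
  have b1: "y = (\<Sum>j<n. u j * \<iota> (E (v j * y)))" and b2: "y = (\<Sum>j<n. \<iota> (E (y * u j)) * v j)" for y
    using basis by (simp_all add: quasi_basis_def)
  have "x * ind = (\<Sum>j<n. x * u j * v j)"
    by (simp add: watatani_index_eq[OF basis] sum_distrib_left mult.assoc)
  also have "\<dots> = (\<Sum>j<n. (\<Sum>i<n. u i * \<iota> (E (v i * (x * u j)))) * v j)"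
    by (simp flip: b1)
  also have "\<dots> = (\<Sum>i<n. u i * (\<Sum>j<n. \<iota> (E (v i * x * u j)) * v j))"
    by (simp add: sum_distrib_left sum_distrib_right mult.assoc, rule sum.swap)
  also have "\<dots> = (\<Sum>i<n. u i * (v i * x))"
    by (simp flip: b2)
  also have "\<dots> = ind * x"
    by (simp add: watatani_index_eq[OF basis] sum_distrib_right mult.assoc)
  finally show ?thesis .
qed

text \<open>The Kadison--Schwarz inequality; the difference is the expectation of
  \<open>(z - E z) (z - E z)*\<close>.\<close>

lemma nonneg_E_Schwarz: "nonneg (E (z * adj z) - E z * adj (E z))"
proof -
  have "E ((z - \<iota> (E z)) * adj (z - \<iota> (E z))) = E (z * adj z) - E z * adj (E z)"
    by (simp add: adj_diff left_diff_distrib right_diff_distrib E_linear E_simps E_adj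
        flip: star_hom_simps(2,3)[OF hom])
  then show ?thesis using nonneg_E[OF nonneg_mult_adj] by metis
qed

text \<open>This replaces the faithfulness of the dual expectation. The matrix \<open>Q\<close> of the difference of both
  sides has entries in \<open>A\<close>. On a row \<open>a\<close> from \<open>A\<close> it takes, with \<open>z = \<Sum> a\<^sub>i y\<^sub>i\<close>, the value
  \<open>(norm x)\<^sup>2 E(z z*) - E(z x) E(z x)*\<close>, which is nonnegative by the Schwarz inequality since
  \<open>z x x* z* \<le> (norm x)\<^sup>2 z z*\<close>. Positivity of matrices passes from \<open>A\<close> to \<open>B\<close>.\<close>

lemma norm_sum_E_square_le:
  "(norm (\<Sum>i<l. t i * \<iota> (E (y i * x))))\<^sup>2
     \<le> (norm x)\<^sup>2 * norm (matrix_form l (\<lambda>i j. \<iota> (E (y i * adj (y j)))) t)"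
proof -
  define C where "C = (norm x)\<^sup>2"
  define Q where "Q i j = C *\<^sub>R E (y i * adj (y j)) - E (y i * x) * adj (E (y j * x))" for i j
  have "adj (Q i j) = Q j i" for i j
    by (simp add: Q_def adj_diff adj_scaleR adj_mult adj_adj flip: E_adj)
  moreover have "nonneg (matrix_form l Q a)" for a
  proof -
    define z where "z = (\<Sum>i<l. \<iota> (a i) * y i)"
    have "matrix_form l Q a = C *\<^sub>R (\<Sum>i<l. \<Sum>j<l. a i * E (y i * adj (y j)) * adj (a j))
        - (\<Sum>i<l. a i * E (y i * x)) * (\<Sum>j<l. adj (E (y j * x)) * adj (a j))"
      by (simp add: matrix_form_def Q_def left_diff_distrib right_diff_distrib sum_subtractf
          scaleR_sum_right sum_product mult.assoc)
    also have "(\<Sum>i<l. \<Sum>j<l. a i * E (y i * adj (y j)) * adj (a j)) = E (z * adj z)"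
      by (simp add: z_def adj_sum adj_mult sum_product E_linear E_simps mult.assoc
          flip: star_hom_simps(3)[OF hom])
        (simp add: E_simps flip: mult.assoc)
    also have "(\<Sum>i<l. a i * E (y i * x)) = E (z * x)"
      by (simp add: z_def sum_distrib_right E_linear E_simps mult.assoc)
    also have "(\<Sum>j<l. adj (E (y j * x)) * adj (a j)) = adj (E (z * x))"
      by (simp add: z_def sum_distrib_right E_linear E_simps mult.assoc adj_sum adj_mult)
    finally have "matrix_form l Q a = E (z * (C *\<^sub>R 1 - x * adj x) * adj z)
        + (E (z * x * adj (z * x)) - E (z * x) * adj (E (z * x)))"
      by (simp add: left_diff_distrib right_diff_distrib E_linear adj_mult mult.assoc)
    moreover have "nonneg (C *\<^sub>R 1 - x * adj x)"
      using nonneg_norm_minus[of "x * adj x"] by (simp add: C_def norm_mult_adj adj_mult adj_adj)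
    ultimately show ?thesis
      by (simp add: nonneg_add nonneg_E nonneg_conj nonneg_E_Schwarz)
  qed
  ultimately have "nonneg (matrix_form l (\<lambda>i j. \<iota> (Q i j)) t)"
    by (rule nonneg_matrix_form_embedding[OF hom \<iota>_one])
  also have "matrix_form l (\<lambda>i j. \<iota> (Q i j)) t
      = C *\<^sub>R matrix_form l (\<lambda>i j. \<iota> (E (y i * adj (y j)))) t
        - (\<Sum>i<l. t i * \<iota> (E (y i * x))) * adj (\<Sum>i<l. t i * \<iota> (E (y i * x)))"
    by (simp add: matrix_form_def Q_def left_diff_distrib right_diff_distrib sum_subtractf
        scaleR_sum_right sum_product adj_sum adj_mult mult.assoc star_hom_simps[OF hom]
        star_hom_scaleR[OF hom])
  finally have "nonneg \<dots>" .
  from norm_le_scaleR_of_nonneg[OF nonneg_mult_adj this] show ?thesis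
    by (simp add: C_def norm_mult_adj)
qed

abbreviation E_seq :: "'b seq_algebra \<Rightarrow> 'a seq_algebra" where "E_seq \<equiv> seq_map E"
abbreviation \<iota>_seq :: "'a seq_algebra \<Rightarrow> 'b seq_algebra" where "\<iota>_seq \<equiv> seq_map \<iota>"

lemmas Bseq_maps = Bseq_bounded_linear[OF bounded_linear_\<iota>] Bseq_bounded_linear[OF bounded_linear_E]

lemma \<iota>_seq_mult: "\<iota>_seq (X * Y) = \<iota>_seq X * \<iota>_seq Y"
  by (cases X rule: seq_algebra_cases; cases Y rule: seq_algebra_cases)
    (simp add: abs_seq_times seq_map_abs Bseq_times Bseq_maps bounded_linear_\<iota>
      star_hom_simps[OF hom])

lemma hom_seq: "star_hom \<iota>_seq"
  unfolding star_hom_def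
  by (simp add: \<iota>_seq_mult seq_map_add seq_map_scaleC seq_map_adj bounded_linear_\<iota> star_hom_simps[OF hom])

lemma \<iota>_seq_const: "\<iota>_seq (const_seq a) = const_seq (\<iota> a)"
  by (simp add: seq_map_const bounded_linear_\<iota>)

lemma E_seq_const: "E_seq (const_seq x) = const_seq (E x)"
  by (simp add: seq_map_const bounded_linear_E)

lemma E_seq_adj: "E_seq (adj X) = adj (E_seq X)"
  by (simp add: seq_map_adj bounded_linear_E E_adj)

lemma E_seq_\<iota>_seq: "E_seq (\<iota>_seq A) = A"
  by (cases A rule: seq_algebra_cases)
    (simp add: seq_map_abs Bseq_maps bounded_linear_\<iota> bounded_linear_E E_simps)

lemma E_seq_bimodule:
  "E_seq (\<iota>_seq A * X) = A * E_seq X" "E_seq (X * \<iota>_seq A) = E_seq X * A"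
  by (cases A rule: seq_algebra_cases; cases X rule: seq_algebra_cases;
      simp add: abs_seq_times seq_map_abs Bseq_times Bseq_maps bounded_linear_\<iota>
        bounded_linear_E E_simps)+

lemma quasi_basis_seq:
  assumes "quasi_basis \<iota> E l y z"
  shows "(\<Sum>j<l. const_seq (y j) * \<iota>_seq (E_seq (const_seq (z j) * X))) = X"
    "(\<Sum>j<l. \<iota>_seq (E_seq (X * const_seq (y j))) * const_seq (z j)) = X"
proof -
  obtain x where X: "X = abs_seq_algebra x" and x: "Bseq x" by (rule seq_algebra_cases)
  have B: "Bseq (\<lambda>_. b)" for b :: 'b by (rule Bfun_const)
  note bounded = B x Bseq_times Bseq_maps bounded_linear_\<iota> bounded_linear_E
  have 1: "(\<Sum>j<l. y j * \<iota> (E (z j * b))) = b" and 2: "(\<Sum>j<l. \<iota> (E (b * y j)) * z j) = b" for b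
    using assms by (simp_all add: quasi_basis_def)
  show "(\<Sum>j<l. const_seq (y j) * \<iota>_seq (E_seq (const_seq (z j) * X))) = X"
    by (simp add: X const_seq_abs abs_seq_times seq_map_abs abs_seq_sum bounded 1)
  show "(\<Sum>j<l. \<iota>_seq (E_seq (X * const_seq (y j))) * const_seq (z j)) = X"
    by (simp add: X const_seq_abs abs_seq_times seq_map_abs abs_seq_sum bounded 2)
qed

text \<open>The preceding estimate, applied to the terms of representing sequences.\<close>

lemma sum_E_seq_eq_0:
  assumes "matrix_form l (\<lambda>i j. const_seq (\<iota> (E (y i * adj (y j))))) t = 0"
  shows "(\<Sum>i<l. t i * const_seq (\<iota> (E (y i * x)))) = 0"
proof -
  have "\<exists>\<tau>. t i = abs_seq_algebra \<tau> \<and> Bseq \<tau>" for i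
    by (meson seq_algebra_cases)
  then obtain \<tau> where t: "t i = abs_seq_algebra (\<tau> i)" and \<tau>: "Bseq (\<tau> i)" for i
    by metis
  have B: "Bseq (\<lambda>_. b)" for b :: 'b by (rule Bfun_const)
  note bounded = B \<tau> Bseq_times Bseq_adj abs_seq_sum(1)
  define M where "M m = matrix_form l (\<lambda>i j. \<iota> (E (y i * adj (y j)))) (\<lambda>i. \<tau> i m)" for m
  define \<sigma> where "\<sigma> m = (\<Sum>i<l. \<tau> i m * \<iota> (E (y i * x)))" for m
  have "Bseq M" unfolding M_def matrix_form_def by (intro bounded)
  moreover have "abs_seq_algebra M = 0"
    using assms unfolding M_def
    by (simp add: matrix_form_def t const_seq_abs abs_seq_times abs_seq_adj abs_seq_sum bounded)
  ultimately have "M \<longlonglongrightarrow> 0" by (simp add: abs_seq_eq_0_iff)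
  then have "(\<lambda>m. (norm x)\<^sup>2 * norm (M m)) \<longlonglongrightarrow> (norm x)\<^sup>2 * 0"
    by (intro tendsto_mult_left tendsto_norm_zero)
  then have lim: "(\<lambda>m. (norm x)\<^sup>2 * norm (M m)) \<longlonglongrightarrow> 0" by simp
  have "(norm (\<sigma> m))\<^sup>2 \<le> (norm x)\<^sup>2 * norm (M m)" for m
    unfolding \<sigma>_def M_def by (rule norm_sum_E_square_le)
  then have "(\<lambda>m. (norm (\<sigma> m))\<^sup>2) \<longlonglongrightarrow> 0"
    by (intro Lim_null_comparison[OF _ lim] always_eventually) simp
  then have "\<sigma> \<longlonglongrightarrow> 0"
    by (simp add: tendsto_norm_zero_iff)
  moreover have "Bseq \<sigma>" unfolding \<sigma>_def by (intro bounded)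
  moreover have "(\<Sum>i<l. t i * const_seq (\<iota> (E (y i * x)))) = abs_seq_algebra \<sigma>"
    unfolding \<sigma>_def by (simp add: t const_seq_abs abs_seq_times abs_seq_sum bounded)
  ultimately show ?thesis by (simp add: abs_seq_eq_0_iff)
qed

end


section \<open>Rokhlin projections\<close>

locale rokhlin_projection = finite_index_expectation \<iota> E n u v
  for \<iota> :: "'a::unital_cstar_algebra \<Rightarrow> 'b::unital_cstar_algebra" and E n u v +
  fixes p :: "'b seq_algebra" and w :: 'b
  assumes p: "projection p" and p_commute: "p * const_seq b = const_seq b * p"
    and w: "w * ind = 1" "ind * w = 1" and E_p: "\<iota>_seq (E_seq p) = const_seq w"
begin

lemma adj_p: "adj p = p" and pp: "p * p = p"
  using p by (simp_all add: projection_def)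

text \<open>This is the operator \<open>p - k p e p\<close> of the basic construction, where \<open>e\<close> is the Jones projection
  and \<open>k\<close> is the index.\<close>

definition defect :: "'b seq_algebra \<Rightarrow> 'b seq_algebra" where
  "defect X = p * X - const_seq ind * p * \<iota>_seq (E_seq (p * X))"

text \<open>\<open>defect\<close> is right \<open>A\<close>-linear, hence determined by its values on a quasi-basis.\<close>

lemma defect_expand:
  "defect (const_seq x) = (\<Sum>j<n. defect (const_seq (u j)) * const_seq (\<iota> (E (v j * x))))"
proof -
  have right: "defect (X * \<iota>_seq A) = defect X * \<iota>_seq A" for X A
    unfolding defect_def mult.assoc[symmetric] E_seq_bimodule \<iota>_seq_mult by (simp add: left_diff_distrib)
  have sum: "defect (sum f S) = (\<Sum>i\<in>S. defect (f i))" for f :: "nat \<Rightarrow> _" and S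
    by (simp add: defect_def sum_distrib_left seq_map_sum bounded_linear_E bounded_linear_\<iota> sum_subtractf)
  have "defect (const_seq x) = defect (\<Sum>j<n. const_seq (u j) * \<iota>_seq (E_seq (const_seq (v j) * const_seq x)))"
    by (simp add: quasi_basis_seq(1)[OF basis])
  also have "\<dots> = (\<Sum>j<n. defect (const_seq (u j)) * \<iota>_seq (E_seq (const_seq (v j) * const_seq x)))"
    by (simp only: sum right)
  also have "\<dots> = (\<Sum>j<n. defect (const_seq (u j)) * const_seq (\<iota> (E (v j * x))))"
    by (simp add: \<iota>_seq_const E_seq_const flip: const_seq_simps(2))
  finally show ?thesis .
qed

text \<open>The vanishing of the dual expectation of \<open>p - k p e p\<close>, written with the quasi-basis. After
  expansion each of the four sums collapses to \<open>p k\<close>: the first through \<open>\<Sum> v\<^sub>j* u\<^sub>j* = k\<close>,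
  the other three through the reconstruction formulas for \<open>p\<close>, and the last also through
  \<open>k E\<^sub>\<infinity>(p) = 1\<close>.\<close>

lemma sum_defect:
  "(\<Sum>j<n. defect (const_seq (adj (v j))) * adj (defect (const_seq (u j)))) = 0"
proof -
  define K where "K = const_seq ind"
  define U where "U j = const_seq (adj (u j))" for j
  define V where "V j = const_seq (adj (v j))" for j
  have Kp: "K * p = p * K" by (simp add: K_def p_commute)
  note qb = quasi_basis_seq[OF quasi_basis_adj, folded U_def V_def]
  have adjd: "adj (defect (const_seq (u j))) = U j * p - \<iota>_seq (E_seq (U j * p)) * p * K" for j
    by (simp add: defect_def U_def K_def adj_diff adj_mult adj_p mult.assoc const_seq_simps(3)[symmetric]
        star_hom_simps(3)[OF hom_seq, symmetric] E_seq_adj[symmetric])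
  have "(\<Sum>j<n. p * V j * U j * p) = p * (\<Sum>j<n. V j * U j) * p"
    by (simp add: sum_distrib_left sum_distrib_right mult.assoc)
  also have "(\<Sum>j<n. V j * U j) = K"
    by (simp add: U_def V_def K_def ind_sum_adj flip: const_seq_simps(2) const_seq_sum)
  finally have 1: "(\<Sum>j<n. p * V j * U j * p) = p * K"
    by (metis Kp mult.assoc pp)
  have "(\<Sum>j<n. p * V j * \<iota>_seq (E_seq (U j * p)) * p * K)
      = p * (\<Sum>j<n. V j * \<iota>_seq (E_seq (U j * p))) * p * K"
    by (simp add: sum_distrib_left sum_distrib_right mult.assoc)
  then have 2: "(\<Sum>j<n. p * V j * \<iota>_seq (E_seq (U j * p)) * p * K) = p * K"
    by (simp add: qb(1) pp)
  have "(\<Sum>j<n. K * p * \<iota>_seq (E_seq (p * V j)) * U j * p)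
      = K * p * (\<Sum>j<n. \<iota>_seq (E_seq (p * V j)) * U j) * p"
    by (simp add: sum_distrib_left sum_distrib_right mult.assoc)
  then have 3: "(\<Sum>j<n. K * p * \<iota>_seq (E_seq (p * V j)) * U j * p) = p * K"
    unfolding qb(2) by (metis Kp mult.assoc pp)
  have "(\<Sum>j<n. \<iota>_seq (E_seq (p * V j)) * \<iota>_seq (E_seq (U j * p)))
      = \<iota>_seq (E_seq ((\<Sum>j<n. \<iota>_seq (E_seq (p * V j)) * U j) * p))"
    by (simp add: sum_distrib_right seq_map_sum bounded_linear_E bounded_linear_\<iota> E_seq_bimodule
        \<iota>_seq_mult mult.assoc)
  also have "\<dots> = const_seq w" by (simp add: qb(2) pp E_p)
  finally have E4: "(\<Sum>j<n. \<iota>_seq (E_seq (p * V j)) * \<iota>_seq (E_seq (U j * p))) = const_seq w" .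
  have Kw: "K * const_seq w = 1"
    by (simp add: K_def w flip: const_seq_simps)
  have "(\<Sum>j<n. K * p * \<iota>_seq (E_seq (p * V j)) * \<iota>_seq (E_seq (U j * p)) * p * K)
      = K * p * (\<Sum>j<n. \<iota>_seq (E_seq (p * V j)) * \<iota>_seq (E_seq (U j * p))) * p * K"
    by (simp add: sum_distrib_left sum_distrib_right mult.assoc)
  also have "\<dots> = K * (p * const_seq w) * p * K"
    by (simp add: E4 mult.assoc)
  also have "\<dots> = (K * const_seq w) * (p * p) * K"
    by (simp add: p_commute mult.assoc)
  finally have 4: "(\<Sum>j<n. K * p * \<iota>_seq (E_seq (p * V j)) * \<iota>_seq (E_seq (U j * p)) * p * K) = p * K"
    by (simp add: Kw pp)
  have "(\<Sum>j<n. defect (const_seq (adj (v j))) * adj (defect (const_seq (u j))))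
     = (\<Sum>j<n. p * V j * U j * p) - (\<Sum>j<n. p * V j * \<iota>_seq (E_seq (U j * p)) * p * K)
       - (\<Sum>j<n. K * p * \<iota>_seq (E_seq (p * V j)) * U j * p)
       + (\<Sum>j<n. K * p * \<iota>_seq (E_seq (p * V j)) * \<iota>_seq (E_seq (U j * p)) * p * K)"
    unfolding adjd
    by (simp add: defect_def V_def[symmetric] K_def[symmetric] left_diff_distrib right_diff_distrib
        sum_subtractf sum.distrib mult.assoc)
  then show ?thesis by (simp add: 1 2 3 4)
qed

text \<open>By \<open>defect_expand\<close> for \<open>v\<^sub>j*\<close>, the sum in \<open>sum_defect\<close> is the value of the matrix
  \<open>E(v\<^sub>i v\<^sub>j*)\<close> at the row of the \<open>defect u\<^sub>j\<close>, which dominates a positive multiple of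
  \<open>defect x\<close> times its adjoint.\<close>

lemma defect_const: "defect (const_seq x) = 0"
proof -
  have "matrix_form n (\<lambda>i j. const_seq (\<iota> (E (v i * adj (v j))))) (\<lambda>j. defect (const_seq (u j)))
      = (\<Sum>j<n. (\<Sum>i<n. defect (const_seq (u i)) * const_seq (\<iota> (E (v i * adj (v j)))))
          * adj (defect (const_seq (u j))))"
    unfolding matrix_form_def by (subst sum.swap) (simp add: sum_distrib_right)
  also have "\<dots> = 0"
    using sum_defect by (simp flip: defect_expand)
  finally show ?thesis
    unfolding defect_expand[of x] by (rule sum_E_seq_eq_0)
qed

text \<open>The constant sequence of \<open>ind\<^sup>-\<^sup>1\<close> equals \<open>E\<^sub>\<infinity>(p)\<close>, so it is fixed by \<open>E\<^sub>\<infinity>\<close>; hence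
  the inverse of the index lies in \<open>A\<close>, and then so does the index.\<close>

lemma ind_in_image: "\<iota> (E ind) = ind"
proof -
  have "const_seq (\<iota> (E w)) = \<iota>_seq (E_seq (\<iota>_seq (E_seq p)))"
    by (simp add: E_p E_seq_const \<iota>_seq_const)
  then have w': "\<iota> (E w) = w" unfolding E_seq_\<iota>_seq unfolding E_p const_seq_inject .
  have "\<iota> (E (ind * \<iota> (E w))) = \<iota> (E ind) * \<iota> (E w)"
    by (simp only: E_simps(5) star_hom_simps(2)[OF hom])
  then have "\<iota> (E ind) * w = 1" by (simp add: w' w)
  then have "\<iota> (E ind) * (w * ind) = ind" by (simp flip: mult.assoc)
  then show ?thesis by (simp add: w)
qed

definition \<psi> :: "'b \<Rightarrow> 'a seq_algebra" where
  "\<psi> b = const_seq (E ind) * E_seq (p * const_seq b)"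

lemma \<psi>_eq: "\<psi> b = E_seq (const_seq ind * p * const_seq b)" "\<psi> b = E_seq (p * const_seq b * const_seq ind)"
proof -
  show 1: "\<psi> b = E_seq (const_seq ind * p * const_seq b)"
    unfolding \<psi>_def mult.assoc E_seq_bimodule(1)[symmetric] \<iota>_seq_const ind_in_image ..
  also have "const_seq ind * p * const_seq b = p * const_seq b * const_seq ind"
    by (metis const_seq_simps(2) ind_central mult.assoc p_commute)
  finally show "\<psi> b = E_seq (p * const_seq b * const_seq ind)" .
qed

text \<open>On the corner cut down by \<open>p\<close>, elements of \<open>B\<close> act as elements of \<open>A\<^sub>\<infinity>\<close>. This makes \<open>\<psi>\<close>
  multiplicative.\<close>

lemma p_\<psi>: "p * const_seq b = p * \<iota>_seq (\<psi> b)"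
proof -
  have "\<iota>_seq (\<psi> b) = const_seq ind * \<iota>_seq (E_seq (p * const_seq b))"
    by (simp add: \<psi>_def \<iota>_seq_mult \<iota>_seq_const ind_in_image)
  then show ?thesis
    using defect_const[of b] p_commute[of ind] by (simp add: defect_def flip: mult.assoc)
qed

lemma \<psi>_mult: "\<psi> (b * d) = \<psi> b * \<psi> d"
proof -
  have "\<psi> b * \<psi> d = const_seq (E ind) * E_seq (p * const_seq b * \<iota>_seq (\<psi> d))"
    by (simp only: \<psi>_def[of b] E_seq_bimodule(2) mult.assoc[of "const_seq (E ind)"])
  also have "p * const_seq b * \<iota>_seq (\<psi> d) = p * const_seq (b * d)"
    by (metis const_seq_simps(2) mult.assoc p_\<psi> p_commute)
  finally show ?thesis by (simp add: \<psi>_def)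
qed

lemma \<psi>_adj: "\<psi> (adj b) = adj (\<psi> b)"
proof -
  have "adj (\<psi> b) = E_seq (const_seq ind * const_seq (adj b) * p)"
    unfolding \<psi>_eq(2) E_seq_adj[symmetric] adj_mult adj_p const_seq_simps(3)[symmetric] adj_ind mult.assoc ..
  then show ?thesis unfolding \<psi>_eq(1) by (simp add: p_commute mult.assoc)
qed

lemma star_hom_\<psi>: "star_hom \<psi>"
  unfolding star_hom_def \<psi>_mult \<psi>_adj
  by (simp add: \<psi>_def const_seq_simps distrib_left seq_map_add bounded_linear_E mult_scaleC_right
      seq_map_scaleC E_simps)

lemma \<psi>_\<iota>: "\<psi> (\<iota> a) = const_seq a"
proof -
  have "\<psi> (\<iota> a) = \<psi> 1 * const_seq a"
    by (simp add: \<psi>_def const_seq_simps E_seq_bimodule(2) mult.assoc flip: \<iota>_seq_const)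
  also have "\<psi> 1 = E_seq (\<iota>_seq (const_seq (E ind) * E_seq p))"
    by (simp add: \<psi>_def const_seq_simps E_seq_\<iota>_seq)
  also have "\<dots> = E_seq (const_seq (ind * w))"
    by (simp add: \<iota>_seq_mult \<iota>_seq_const ind_in_image E_p const_seq_simps)
  also have "\<dots> = const_seq (E (ind * w))" by (rule E_seq_const)
  also have "\<dots> = 1" by (simp add: w const_seq_simps)
  finally show ?thesis by simp
qed

end

theorem theorem4p16:
  fixes \<iota> :: "'a::unital_cstar_algebra \<Rightarrow> 'b::unital_cstar_algebra"
  assumes "separable_space (euclidean :: 'a topology)"
    and "separable_space (euclidean :: 'b topology)"
    and "unital_inclusion \<iota>"
    and "inclusion_rokhlin \<iota>"
  shows "sequentially_split \<iota>"
proof -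
  from assms(4) obtain E n u v p w where *:
    "conditional_expectation \<iota> E" "quasi_basis \<iota> E n u v"
    "projection p" "\<forall>b. p * const_seq b = const_seq b * p"
    "w * watatani_index \<iota> E = 1" "watatani_index \<iota> E * w = 1"
    "seq_map \<iota> (seq_map E p) = const_seq w"
    unfolding inclusion_rokhlin_def finite_watatani_index_def expectation_rokhlin_def by blast
  interpret rokhlin_projection \<iota> E n u v p w
    by unfold_locales (use * assms(3) in auto)
  have "\<psi> \<circ> \<iota> = const_seq" by (simp add: fun_eq_iff \<psi>_\<iota>)
  then show ?thesis
    unfolding sequentially_split_def using hom star_hom_\<psi> by blast
qed

end
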